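(* Let $\alpha\in\mathbb{C}$, $\theta\in\mathbb{R}$, and let $p$ be a positive integer. Suppose $\varpi_p(\xi)$ is the generating function of a convolution quadrature (CQ) for $I^{\alpha}$ that is convergent of order $p$. Define $$\omega(\xi)=\varpi_p(\xi)\big[\gamma''_0+\gamma''_1(1-\xi)+\cdots+\gamma''_{p-1}(1-\xi)^{p-1}\big],$$ where the coefficients $\gamma''_i$ are determined by $$\sum_{i=0}^{\infty}\gamma''_i(1-\xi)^i=\xi^{\theta}.$$ Then the shifted convolution quadrature (SCQ) with shift $\theta$ and convolution weights generated by $\omega(\xi)$ is convergent of order $p$ to $I^{\alpha}$.
   Context: Riemann-Liouville operators: for $\Re\alpha>0$, $I^{\alpha}f(x)=\frac{1}{\Gamma(\alpha)}\int_0^x (x-s)^{\alpha-1}f(s)\,ds$; $I^{-\alpha}f(x)=\frac{d^n}{dx^n}I^{n-\alpha}f(x)$ with $n=\lceil\Re\alpha\rceil$; $I^0$ is the identity. On powers, for $\beta\in\mathbb{C}$, $\beta\neq 0,-1,-2,\dots$, $(I^{\alpha}t^{\beta-1})(x)=\frac{\Gamma(\beta)}{\Gamma(\alpha+\beta)}x^{\alpha+\beta-1}$ (understood by analytic continuation in $\beta$ where the integral diverges, with $1/\Gamma=0$ at the poles of $\Gamma$). SCQ: for a step size $h>0$, weights $\omega_j\in\mathbb{C}$ with generating function $\omega(\xi)=\sum_{j\ge0}\omega_j\xi^j$, and shift $\theta$, the convolution part is $$\Omega_h^{\alpha}f(x)=h^{\alpha}\sum_{0\le jh\le x+\theta h}\omega_j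 f\big(x+(\theta-j)h\big),$$ and the convolution error is $E_h^{\alpha}=\Omega_h^{\alpha}-I^{\alpha}$; $(E_h^{\alpha}t^{\beta-1})(x)$ denotes $E_h^\alpha$ applied to $t\mapsto t^{\beta-1}$ evaluated at $x$. If $\Re\beta<1$, a term in which $t^{\beta-1}$ would be evaluated at $t=0$ is read as $0$. Convergent of order $p$ to $I^{\alpha}$: $(E_h^{\alpha}t^{\beta-1})(1)=O(h^{\beta})+O(h^p)$ as $h\to 0^+$, for all $\beta\in\mathbb{C}$ with $\beta\ne0,-1,-2,\dots$ (the implied constants may depend on $\beta$). A CQ is the special case $\theta=0$ of an SCQ, with the same definition of convergence of order $p$ (taken with $\theta=0$). *)

theory Defs
  imports "HOL-Complex_Analysis.Complex_Analysis" "HOL-Library.Landau_Symbols"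
begin

section \<open>Riemann-Liouville operators\<close>

definition RL_integral :: "complex \<Rightarrow> (real \<Rightarrow> complex) \<Rightarrow> real \<Rightarrow> complex" where
  "RL_integral \<alpha> f x =
     1 / Gamma \<alpha> * integral {0..x} (\<lambda>s. complex_of_real (x - s) powr (\<alpha> - 1) * f s)"

text \<open>
  The order \<open>n\<close> of the outer derivative for \<open>Re \<alpha> \<le> 0\<close>. It is \<open>\<lceil>Re (-\<alpha>)\<rceil>\<close>, except when
  \<open>Re \<alpha>\<close> is an integer and \<open>\<alpha>\<close> is not real: there \<open>\<lceil>Re (-\<alpha>)\<rceil> + \<alpha>\<close> would be a nonzero
  purely imaginary order, for which no integral is available, and one more derivative is taken.
\<close>
definition RL_order :: "complex \<Rightarrow> nat" where
  "RL_order \<alpha> = nat (if Im \<alpha> = 0 then \<lceil>- Re \<alpha>\<rceil> else \<lfloor>- Re \<alpha>\<rfloor> + 1)"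

definition riemann_liouville :: "complex \<Rightarrow> (real \<Rightarrow> complex) \<Rightarrow> real \<Rightarrow> complex" where
  "riemann_liouville \<alpha> f =
     (if \<alpha> = 0 then f
      else if Re \<alpha> > 0 then RL_integral \<alpha> f
      else let n = RL_order \<alpha>
           in ((\<lambda>g x. vector_derivative g (at x)) ^^ n)
                (if of_nat n + \<alpha> = 0 then f else RL_integral (of_nat n + \<alpha>) f))"

text \<open>
  The function \<open>t \<mapsto> t\<^bsup>\<beta>-1\<^esup>\<close> on \<open>t \<ge> 0\<close>. The library has \<open>0 powr z = 0\<close> for all \<open>z\<close>, which at
  \<open>t = 0\<close> is the required reading for \<open>Re \<beta> < 1\<close>; the constant function \<open>\<beta> = 1\<close> has to be
  singled out.
\<close>
definition power_fun :: "complex \<Rightarrow> real \<Rightarrow> complex" where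
  "power_fun \<beta> t = (if \<beta> = 1 then 1 else complex_of_real t powr (\<beta> - 1))"

text \<open>
  \<open>(I\<^sup>\<alpha> t\<^bsup>\<beta>-1\<^esup>)(x)\<close> for \<open>\<beta> \<noteq> 0, -1, -2, \<dots>\<close>, by analytic continuation in \<open>\<beta>\<close> from the half
  plane \<open>Re \<beta> > 0\<close>, where the integral converges. That the continuation exists and is given by
  the usual quotient of Gamma functions is lemma \<open>RL_power_eq\<close> below.
\<close>
definition RL_power :: "complex \<Rightarrow> complex \<Rightarrow> real \<Rightarrow> complex" where
  "RL_power \<alpha> \<beta> x =
     (SOME F. F holomorphic_on (- \<int>\<^sub>\<le>\<^sub>0) \<and>
        (\<forall>b. Re b > 0 \<longrightarrow> F b = riemann_liouville \<alpha> (power_fun b) x)) \<beta>"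


section \<open>Shifted convolution quadrature\<close>

text \<open>
  The weights \<open>\<omega>\<^sub>j\<close> are the coefficients of the formal power series \<open>\<omega>\<close>, their generating function.
\<close>
definition scq :: "complex \<Rightarrow> complex fps \<Rightarrow> real \<Rightarrow> real \<Rightarrow> (real \<Rightarrow> complex) \<Rightarrow> real \<Rightarrow> complex" where
  "scq \<alpha> \<omega> \<theta> h f x =
     complex_of_real h powr \<alpha> *
       (\<Sum>j | real j * h \<le> x + \<theta> * h. fps_nth \<omega> j * f (x + (\<theta> - real j) * h))"

definition scq_power_error :: "complex \<Rightarrow> complex fps \<Rightarrow> real \<Rightarrow> real \<Rightarrow> complex \<Rightarrow> real \<Rightarrow> complex" where
  "scq_power_error \<alpha> \<omega> \<theta> h \<beta> x = scq \<alpha> \<omega> \<theta> h (power_fun \<beta>) x - RL_power \<alpha> \<beta> x"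

text \<open>
  Convergence of order \<open>p\<close>. The filter \<open>F\<close> says how the step size \<open>h\<close> tends to \<open>0\<close> from above:
  through all positive reals (\<open>F = at_right 0\<close>), or through the step sizes
  \<open>h = 1/N\<close> for which \<open>x = 1\<close> is a grid point. The second choice matters for weights with infinitely
  many nonzero terms: if \<open>h\<close> is arbitrary, the sample point \<open>1 - N h\<close> of a CQ can be arbitrarily close
  to \<open>0\<close>, where \<open>t\<^bsup>\<beta>-1\<^esup>\<close> is unbounded for \<open>Re \<beta> < 1\<close>.
\<close>
definition scq_convergent :: "real filter \<Rightarrow> complex \<Rightarrow> complex fps \<Rightarrow> real \<Rightarrow> nat \<Rightarrow> bool" where
  "scq_convergent F \<alpha> \<omega> \<theta> p \<longleftrightarrow>
     (\<forall>\<beta>. \<beta> \<notin> \<int>\<^sub>\<le>\<^sub>0 \<longrightarrow>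
        (\<exists>u v. u \<in> O[F](\<lambda>h. complex_of_real h powr \<beta>) \<and>
               v \<in> O[F](\<lambda>h. complex_of_real h ^ p) \<and>
               (\<forall>\<^sub>F h in F. scq_power_error \<alpha> \<omega> \<theta> h \<beta> 1 = u h + v h)))"

definition cq_convergent :: "real filter \<Rightarrow> complex \<Rightarrow> complex fps \<Rightarrow> nat \<Rightarrow> bool" where
  "cq_convergent F \<alpha> \<omega> p \<longleftrightarrow> scq_convergent F \<alpha> \<omega> 0 p"


section \<open>The Riemann-Liouville operator on powers\<close>

lemma Gamma_nonzero: "Re z > 0 \<Longrightarrow> Gamma z \<noteq> 0" for z :: complex
  by (auto simp: Gamma_eq_zero_iff elim!: nonpos_Ints_cases)

text \<open>A Borel measurable version of \<open>t powr c\<close>, extended by \<open>0\<close> to the negative axis.\<close>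
definition pw :: "complex \<Rightarrow> real \<Rightarrow> complex" where
  "pw c t = (if t > 0 then exp (c * of_real (ln t)) else 0)"

lemma pw_eq_powr: "t \<ge> 0 \<Longrightarrow> pw c t = of_real t powr c"
  by (auto simp: pw_def powr_def Ln_of_real)

lemma pw_measurable [measurable]: "pw c \<in> borel_measurable borel"
  unfolding pw_def by measurable

lemma pw_nonpos [simp]: "t \<le> 0 \<Longrightarrow> pw c t = 0"
  by (auto simp: pw_def)

lemma pw_add: "pw c t * pw d t = pw (c + d) t"
  by (auto simp: pw_def exp_add ring_distribs)

lemma pw_scale: "x > 0 \<Longrightarrow> pw c (x * t) = pw c x * pw c t"
  by (auto simp: pw_def ln_mult zero_less_mult_iff ring_distribs exp_add)

lemma pw_one_mult: "of_real t * pw c t = pw (c + 1) t" if "t > 0"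
  using that by (simp add: pw_def ring_distribs exp_add exp_of_real)

lemma norm_pw: "norm (pw c t) = (if t > 0 then t powr Re c else 0)"
  by (auto simp: pw_def powr_def)

lemma pw_Gamma:
  assumes "Re a > 0"
  shows "integrable lborel (\<lambda>t. pw (a - 1) t * of_real (exp (- t)))"
    and "(LINT t|lborel. pw (a - 1) t * of_real (exp (- t))) = Gamma a"
proof -
  have eq: "indicat_real {0<..} t *\<^sub>R (complex_of_real t powr (a - 1) / of_real (exp t))
      = pw (a - 1) t * of_real (exp (- t))" for t
    by (auto simp: pw_eq_powr indicator_def exp_minus divide_inverse)
  have "integrable lebesgue (\<lambda>t. pw (a - 1) t * of_real (exp (- t)))"
    using absolutely_integrable_Gamma_integral'[OF assms]
    unfolding set_integrable_def eq .
  then show int: "integrable lborel (\<lambda>t. pw (a - 1) t * of_real (exp (- t)))"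
    by (subst (asm) integrable_completion) auto
  have "set_integrable lborel {0<..} (\<lambda>t. complex_of_real t powr (a - 1) / of_real (exp t))"
    unfolding set_integrable_def eq using int .
  from set_borel_integral_eq_integral(2)[OF this]
  show "(LINT t|lborel. pw (a - 1) t * of_real (exp (- t))) = Gamma a"
    using Gamma_integral_complex'[OF assms]
    unfolding set_lebesgue_integral_def eq by (simp add: integral_unique)
qed

text \<open>The integrand of \<open>\<Gamma>(a) I\<^sup>a t\<^bsup>b-1\<^esup>\<close> at \<open>x\<close>; it vanishes for \<open>t\<close> outside \<open>(0, x)\<close>.\<close>
definition bk :: "complex \<Rightarrow> complex \<Rightarrow> real \<Rightarrow> real \<Rightarrow> complex" where
  "bk a b x t = pw (a - 1) (x - t) * pw (b - 1) t"

lemma bk_measurable [measurable]: "bk a b x \<in> borel_measurable borel"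
  unfolding bk_def by measurable

lemma bk_nonpos: "x \<le> 0 \<Longrightarrow> bk a b x t = 0"
  by (cases "t > 0") (auto simp: bk_def)

lemma bk_scale: "x > 0 \<Longrightarrow> bk a b x (x * t) = pw (a + b - 2) x * bk a b 1 t"
  using pw_scale[of x "a - 1" "1 - t"] pw_scale[of x "b - 1" t] pw_add[of "a - 1" x "b - 1"]
  by (simp add: bk_def right_diff_distrib algebra_simps)

lemma bk_integrable_1:
  assumes "Re a > 0" "Re b > 0"
  shows "integrable lborel (bk a b 1)"
proof -
  have "integrable lborel (\<lambda>t. indicat_real {0..1} t *\<^sub>R (t powr (Re b - 1) * (1 - t) powr (Re a - 1)))"
    using integrable_Beta[OF assms(2,1)] by (simp add: set_integrable_def)
  then show ?thesis
    by (rule Bochner_Integration.integrable_bound)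
       (auto simp: bk_def norm_mult norm_pw indicator_def)
qed

lemma bk_integrable:
  assumes "Re a > 0" "Re b > 0"
  shows "integrable lborel (bk a b x)"
proof (cases "x > 0")
  case True
  have "integrable lborel (\<lambda>t. bk a b x (0 + x * t))"
    using bk_integrable_1[OF assms] by (simp add: bk_scale[OF True])
  then show ?thesis
    using lborel_integrable_real_affine_iff[of x "bk a b x" 0] True by simp
next
  case False
  then have "bk a b x = (\<lambda>t. 0)"
    by (simp add: bk_nonpos fun_eq_iff)
  then show ?thesis by simp
qed

lemma bk_integral:
  assumes "x > 0"
  shows "(LINT t|lborel. bk a b x t) = pw (a + b - 1) x * (LINT t|lborel. bk a b 1 t)"
    and "(LINT t|lborel. norm (bk a b x t)) = x powr (Re (a + b) - 1) * (LINT t|lborel. norm (bk a b 1 t))"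
proof -
  have "of_real x * pw (a + b - 2) x = pw (a + b - 1) x"
    using pw_one_mult[OF assms, of "a + b - 2"] by simp
  then show "(LINT t|lborel. bk a b x t) = pw (a + b - 1) x * (LINT t|lborel. bk a b 1 t)"
    using lborel_integral_real_affine[of x "bk a b x" 0] assms
    by (simp add: bk_scale scaleR_conv_of_real flip: mult.assoc)
  have "x * x powr (Re (a + b) - 2) = x powr (Re (a + b) - 1)"
    using assms powr_add[of x 1 "Re (a + b) - 2"] by simp
  then show "(LINT t|lborel. norm (bk a b x t)) = x powr (Re (a + b) - 1) * (LINT t|lborel. norm (bk a b 1 t))"
    using lborel_integral_real_affine[of x "\<lambda>t. norm (bk a b x t)" 0] assms
    by (simp add: bk_scale norm_mult norm_pw flip: mult.assoc)
qed

lemma bk_Beta: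
  assumes "Re a > 0" "Re b > 0"
  shows "(LINT t|lborel. bk a b 1 t) = Gamma a * Gamma b * rGamma (a + b)"
proof -
  define B where "B = (LINT t|lborel. bk a b 1 t)"
  define C where "C = (LINT t|lborel. norm (bk a b 1 t))"
  define f where "f = (\<lambda>s u. of_real (exp (- s)) * bk a b s u)"
  have meas: "case_prod f \<in> borel_measurable (lborel \<Otimes>\<^sub>M lborel)"
    unfolding f_def bk_def by measurable
  have ab: "Re (a + b) > 0" using assms by simp
  have "integrable lborel (\<lambda>s. norm (pw (a + b - 1) s * of_real (exp (- s))) * C)"
    using pw_Gamma(1)[OF ab] by (intro integrable_mult_left integrable_norm)
  also have "(\<lambda>s. norm (pw (a + b - 1) s * of_real (exp (- s))) * C)
      = (\<lambda>s. LINT u|lborel. norm (f s u))"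
  proof
    fix s :: real
    show "norm (pw (a + b - 1) s * of_real (exp (- s))) * C = (LINT u|lborel. norm (f s u))"
    proof (cases "s > 0")
      case True
      have "(LINT u|lborel. norm (f s u)) = exp (- s) * (LINT u|lborel. norm (bk a b s u))"
        unfolding f_def norm_mult norm_of_real abs_exp_cancel
        by (rule integral_mult_right_zero)
      then show ?thesis
        unfolding bk_integral(2)[OF True] C_def[symmetric] norm_mult norm_of_real abs_exp_cancel norm_pw
        using True by simp
    qed (simp add: f_def bk_nonpos)
  qed
  finally have "integrable (lborel \<Otimes>\<^sub>M lborel) (case_prod f)"
  proof (intro lborel_pair.Fubini_integrable[OF meas] AE_I2)
    show "integrable lborel (\<lambda>u. case_prod f (s, u))" for s
      unfolding f_def prod.case by (intro integrable_mult_right bk_integrable assms)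
  qed simp
  from lborel_pair.Fubini_integral[OF this]
  have "(LINT u|lborel. LINT s|lborel. f s u) = (LINT s|lborel. LINT u|lborel. f s u)" .
  also have "(LINT s|lborel. LINT u|lborel. f s u) = (LINT s|lborel. B * (pw (a + b - 1) s * of_real (exp (- s))))"
  proof (rule Bochner_Integration.integral_cong[OF refl])
    fix s :: real
    show "(LINT u|lborel. f s u) = B * (pw (a + b - 1) s * of_real (exp (- s)))"
    proof (cases "s > 0")
      case True
      have "(LINT u|lborel. f s u) = of_real (exp (- s)) * (LINT u|lborel. bk a b s u)"
        unfolding f_def by (rule integral_mult_right_zero)
      then show ?thesis
        unfolding bk_integral(1)[OF True] B_def[symmetric] by (simp only: ac_simps)
    qed (simp add: f_def bk_nonpos)
  qed
  also have "\<dots> = B * Gamma (a + b)"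
    unfolding integral_mult_right_zero pw_Gamma(2)[OF ab] ..
  finally have swap: "(LINT u|lborel. LINT s|lborel. f s u) = B * Gamma (a + b)" .
  have split: "exp (- u - s) = exp (- u) * exp (- s)" for u s :: real
    by (simp flip: exp_add)
  have inner: "(LINT s|lborel. f s u) = Gamma a * (pw (b - 1) u * of_real (exp (- u)))" for u
  proof -
    have "(LINT s|lborel. f s u) = (LINT s|lborel. f (u + 1 * s) u)"
      using lborel_integral_real_affine[of 1 "\<lambda>s. f s u" u] by simp
    also have "\<dots> = (LINT s|lborel. (pw (b - 1) u * of_real (exp (- u))) * (pw (a - 1) s * of_real (exp (- s))))"
      by (intro Bochner_Integration.integral_cong refl) (simp add: f_def bk_def split)
    also have "\<dots> = Gamma a * (pw (b - 1) u * of_real (exp (- u)))"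
      unfolding integral_mult_right_zero pw_Gamma(2)[OF assms(1)] by (rule mult.commute)
    finally show ?thesis .
  qed
  have "(LINT u|lborel. LINT s|lborel. f s u) = Gamma a * Gamma b"
    unfolding inner integral_mult_right_zero pw_Gamma(2)[OF assms(2)] ..
  with swap have "B * Gamma (a + b) = Gamma a * Gamma b" by simp
  moreover have "Gamma (a + b) * rGamma (a + b) = 1"
    using Gamma_nonzero[OF ab] by (simp add: rGamma_inverse_Gamma)
  ultimately have "Gamma a * Gamma b * rGamma (a + b) = B"
    by (simp only: mult.assoc mult_1_right flip: \<open>B * Gamma (a + b) = Gamma a * Gamma b\<close>)
  then show ?thesis
    unfolding B_def ..
qed


lemma RL_integral_power:
  assumes "Re a > 0" "Re b > 0" "x > 0"
  shows "RL_integral a (power_fun b) x = Gamma b * rGamma (a + b) * of_real x powr (a + b - 1)"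
proof -
  have "integral {0..x} (\<lambda>s. complex_of_real (x - s) powr (a - 1) * power_fun b s)
      = integral {0..x} (bk a b x)"
  proof (rule integral_spike[of "{0}"])
    fix s assume "s \<in> {0..x} - {0}"
    then show "bk a b x s = complex_of_real (x - s) powr (a - 1) * power_fun b s"
      using pw_eq_powr[of "x - s" "a - 1"] pw_eq_powr[of s "b - 1"]
      by (auto simp: bk_def power_fun_def)
  qed simp
  also have "\<dots> = (LINT s|lborel. bk a b x s)"
  proof -
    have eq: "indicat_real {0..x} s *\<^sub>R bk a b x s = bk a b x s" for s
      by (auto simp: indicator_def bk_def)
    have "set_integrable lborel {0..x} (bk a b x)"
      unfolding set_integrable_def eq by (rule bk_integrable[OF assms(1,2)])
    from set_borel_integral_eq_integral(2)[OF this] show ?thesis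
      unfolding set_lebesgue_integral_def eq by simp
  qed
  also have "\<dots> = of_real x powr (a + b - 1) * (Gamma a * Gamma b * rGamma (a + b))"
    using assms(3) by (simp only: bk_integral(1)[OF assms(3)] bk_Beta[OF assms(1,2)] pw_eq_powr less_imp_le)
  finally have eq: "integral {0..x} (\<lambda>s. complex_of_real (x - s) powr (a - 1) * power_fun b s)
      = of_real x powr (a + b - 1) * (Gamma a * Gamma b * rGamma (a + b))" .
  have "Gamma a \<noteq> 0"
    using assms(1) by (rule Gamma_nonzero)
  then show ?thesis
    unfolding RL_integral_def eq by simp
qed

lemma iterated_vector_derivative_power:
  fixes g :: "real \<Rightarrow> complex"
  assumes "\<And>x. x > 0 \<Longrightarrow> g x = C * rGamma c * of_real x powr (c - 1)" and "x > 0"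
  shows "((\<lambda>g x. vector_derivative g (at x)) ^^ n) g x
           = C * rGamma (c - of_nat n) * of_real x powr (c - of_nat n - 1)"
  using assms(2)
proof (induction n arbitrary: x)
  case 0
  then show ?case using assms(1) by simp
next
  case (Suc n)
  define d where "d = c - of_nat n"
  let ?h = "\<lambda>x. C * rGamma d * complex_of_real x powr (d - 1)"
  have "((\<lambda>z. z powr (d - 1)) has_field_derivative (d - 1) * of_real x powr (d - 1 - 1))
          (at (complex_of_real x))"
    using Suc.prems by (intro has_field_derivative_powr) auto
  from has_vector_derivative_real_field[OF this]
  have "((\<lambda>x. complex_of_real x powr (d - 1)) has_vector_derivative
          (d - 1) * of_real x powr (d - 1 - 1)) (at x)" .
  then have "(?h has_vector_derivative C * rGamma d * ((d - 1) * of_real x powr (d - 1 - 1))) (at x)"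
    by (rule has_vector_derivative_mult_right)
  then have "(((\<lambda>g x. vector_derivative g (at x)) ^^ n) g has_vector_derivative
               C * rGamma d * ((d - 1) * of_real x powr (d - 1 - 1))) (at x)"
    by (rule has_vector_derivative_transform_within_open[of _ _ _ "{0<..}"])
       (use Suc in \<open>auto simp: d_def\<close>)
  then have "((\<lambda>g x. vector_derivative g (at x)) ^^ Suc n) g x
               = C * rGamma d * ((d - 1) * of_real x powr (d - 1 - 1))"
    by (simp add: vector_derivative_at)
  also have "\<dots> = C * ((d - 1) * rGamma (d - 1 + 1)) * of_real x powr (d - 1 - 1)"
    by simp
  also have "\<dots> = C * rGamma (d - 1) * of_real x powr (d - 1 - 1)"
    by (simp only: rGamma_plus1)
  finally show ?case by (simp add: d_def algebra_simps)
qed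

lemma riemann_liouville_power:
  assumes "Re b > 0" "x > 0"
  shows "riemann_liouville a (power_fun b) x = Gamma b * rGamma (a + b) * of_real x powr (a + b - 1)"
proof -
  have one: "Gamma b * rGamma b = 1"
    using Gamma_nonzero[OF assms(1)] by (simp add: rGamma_inverse_Gamma)
  have pf: "power_fun b y = Gamma b * rGamma b * of_real y powr (b - 1)" if "y > 0" for y
    using that one by (simp add: power_fun_def)
  consider "a = 0" | "a \<noteq> 0" "Re a > 0" | "a \<noteq> 0" "Re a \<le> 0" by linarith
  then show ?thesis
  proof cases
    case 1
    then show ?thesis using pf[OF assms(2)] by (simp add: riemann_liouville_def)
  next
    case 2
    then show ?thesis using assms by (simp add: riemann_liouville_def RL_integral_power)
  next
    case 3
    define n where "n = RL_order a"
    define g where "g = (if of_nat n + a = 0 then power_fun b else RL_integral (of_nat n + a) (power_fun b))"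
    have pos: "Re (of_nat n + a) > 0" if "of_nat n + a \<noteq> 0"
    proof (cases "Im a = 0")
      case True
      have "real n = of_int \<lceil>- Re a\<rceil>"
        using 3 True by (simp add: n_def RL_order_def)
      moreover have "of_int \<lceil>- Re a\<rceil> \<ge> - Re a" by (rule le_of_int_ceiling)
      moreover have "real n + Re a \<noteq> 0" using that True by (auto simp: complex_eq_iff)
      ultimately have "real n + Re a > 0" by linarith
      then show ?thesis by simp
    next
      case False
      have "\<lfloor>- Re a\<rfloor> \<ge> 0" using 3 by simp
      then have "real n = of_int \<lfloor>- Re a\<rfloor> + 1"
        using False by (simp add: n_def RL_order_def)
      moreover have "- Re a < of_int \<lfloor>- Re a\<rfloor> + 1" by (rule floor_correct[THEN conjunct2, simplified of_int_add of_int_1])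
      ultimately have "real n + Re a > 0" by linarith
      then show ?thesis by simp
    qed
    have g: "g y = Gamma b * rGamma (of_nat n + a + b) * of_real y powr (of_nat n + a + b - 1)"
      if "y > 0" for y
    proof (cases "of_nat n + a = 0")
      case True
      then show ?thesis unfolding g_def True using pf[OF that] by simp
    next
      case False
      then show ?thesis unfolding g_def using RL_integral_power[OF pos[OF False] assms(1) that] by simp
    qed
    have "riemann_liouville a (power_fun b) x = ((\<lambda>g x. vector_derivative g (at x)) ^^ n) g x"
      using 3 by (simp add: riemann_liouville_def Let_def g_def flip: n_def)
    also have "\<dots> = Gamma b * rGamma (of_nat n + a + b - of_nat n)
                       * of_real x powr (of_nat n + a + b - of_nat n - 1)"
      by (rule iterated_vector_derivative_power[OF g assms(2)])
    also have "of_nat n + a + b - of_nat n = a + b" by simp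
    finally show ?thesis .
  qed
qed

lemma RL_power_eq:
  assumes "\<beta> \<notin> \<int>\<^sub>\<le>\<^sub>0" "x > 0"
  shows "RL_power \<alpha> \<beta> x = Gamma \<beta> * rGamma (\<alpha> + \<beta>) * of_real x powr (\<alpha> + \<beta> - 1)"
proof -
  define P where "P = (\<lambda>F. F holomorphic_on (- \<int>\<^sub>\<le>\<^sub>0) \<and>
        (\<forall>b. Re b > 0 \<longrightarrow> F b = riemann_liouville \<alpha> (power_fun b) x))"
  define G where "G = (\<lambda>b. Gamma b * rGamma (\<alpha> + b) * complex_of_real x powr (\<alpha> + b - 1))"
  have holG: "G holomorphic_on (- \<int>\<^sub>\<le>\<^sub>0)"
  proof -
    have "G = (\<lambda>b. Gamma b * rGamma (\<alpha> + b) * exp ((\<alpha> + b - 1) * Ln (complex_of_real x)))"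
      using assms(2) by (simp add: G_def powr_def)
    moreover have "Gamma holomorphic_on (- \<int>\<^sub>\<le>\<^sub>0 :: complex set)"
      by (rule holomorphic_Gamma) auto
    ultimately show ?thesis
      by (auto intro!: holomorphic_on_mult holomorphic_rGamma' holomorphic_on_exp'
          holomorphic_on_add holomorphic_on_diff holomorphic_on_const holomorphic_on_ident)
  qed
  have "P G"
    using holG riemann_liouville_power[OF _ assms(2)] by (simp add: P_def G_def)
  then have P: "P (Eps P)" by (rule someI[of P G])
  have "connected (UNIV - (\<int>\<^sub>\<le>\<^sub>0 :: complex set))"
    by (rule connected_open_diff_countable[OF _ open_UNIV connected_UNIV
          countable_subset[OF nonpos_Ints_subset_Ints countable_int]]) simp
  then have conn: "connected (- (\<int>\<^sub>\<le>\<^sub>0 :: complex set))"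
    by (simp add: Compl_eq_Diff_UNIV)
  have "Eps P \<beta> = G \<beta>"
  proof (rule analytic_continuation_open[where z = \<beta> and s = "{b. Re b > 0}" and s' = "- \<int>\<^sub>\<le>\<^sub>0"])
    show "{b. Re b > 0} \<noteq> {}" by (auto intro: exI[of _ 1])
    show "{b. Re b > 0} \<subseteq> - \<int>\<^sub>\<le>\<^sub>0" by (auto elim!: nonpos_Ints_cases)
    show "Eps P holomorphic_on - \<int>\<^sub>\<le>\<^sub>0" "G holomorphic_on - \<int>\<^sub>\<le>\<^sub>0"
      using P \<open>P G\<close> by (simp_all only: P_def)
    show "Eps P z = G z" if "z \<in> {b. Re b > 0}" for z
      using that P \<open>P G\<close> unfolding P_def by simp
  qed (use assms(1) conn in \<open>auto simp: open_halfspace_Re_gt\<close>)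
  then show ?thesis by (simp add: RL_power_def G_def P_def)
qed

end

theory Submission
  imports Defs "HOL-Real_Asymp.Real_Asymp"
begin

text \<open>
  Put \<open>y = 1/h\<close>. The shifted quadrature of \<open>t\<^bsup>\<beta>-1\<^esup>\<close> is, up to a power of \<open>h\<close>, the discrete convolution
  at \<open>y\<close> of the weights of \<open>\<omega>\<^sub>p\<close> with \<open>D(t) = \<Sum>\<^sub>k q\<^sub>k (t + \<theta> - k)\<^bsup>\<beta>-1\<^esup>\<close>, where
  \<open>q(\<xi>) = \<Sum>\<^sub>i \<gamma>\<^sub>i (1 - \<xi>)\<^sup>i\<close>. Since \<open>q(e\<^bsup>-s\<^esup>) e\<^bsup>\<theta>s\<^esup> = 1 + O(s\<^sup>p)\<close>, the expansion of \<open>D\<close> at infinity is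
  \<open>t\<^bsup>\<beta>-1\<^esup> + \<Sum>\<^bsub>p \<le> r < R\<^esub> c\<^sub>r t\<^bsup>\<beta>-1-r\<^esup> + H(t)\<close> with \<open>H\<close> decaying as fast as desired. The hypothesis,
  applied to \<open>\<beta>\<close> and to all \<open>\<beta> - r\<close>, handles the powers. The convolution with \<open>H\<close> needs only
  stability of the weights, which follows from the hypothesis as well: for \<open>h = 1/N\<close>, differencing the case
  \<open>\<beta> = 1\<close> gives \<open>\<omega>\<^sub>n = O(n\<^bsup>\<alpha>-1\<^esup>)\<close>; for arbitrary \<open>h\<close>, the singularity of \<open>t\<^bsup>-1/2\<^esup>\<close> at a
  sample point close to \<open>0\<close> forces all but finitely many weights to vanish.
\<close>

section \<open>Expansion of shifted powers\<close>

text \<open>The remainder is z^R times the sum of the shifted series, which is continuous at 0 and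
  hence bounded there. The filter \<open>nhds 0\<close> includes the point 0 itself, so the bound
  can be composed with a quotient a/t that is identically 0 when a = 0.\<close>

lemma fps_expansion_remainder_bigo:
  fixes f :: "complex \<Rightarrow> complex"
  assumes "f has_fps_expansion F"
  shows "(\<lambda>z. f z - (\<Sum>r<R. fps_nth F r * z ^ r)) \<in> O[nhds 0](\<lambda>z. z ^ R)"
proof -
  let ?g = "eval_fps (fps_shift R F)"
  have "fps_conv_radius F > 0" and ev: "\<forall>\<^sub>F z in nhds 0. eval_fps F z = f z"
    using assms by (auto simp: has_fps_expansion_def)
  then have "\<forall>\<^sub>F z in nhds 0. z \<in> eball 0 (fps_conv_radius F)"
    by (intro eventually_nhds_in_open) (auto simp: zero_ereal_def)
  with ev have eq: "\<forall>\<^sub>F z in nhds 0. f z - (\<Sum>r<R. fps_nth F r * z ^ r) = ?g z * z ^ R"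
  proof eventually_elim
    case (elim z)
    have "f z = (\<Sum>r. fps_nth F (r + R) * z ^ (r + R)) + (\<Sum>r<R. fps_nth F r * z ^ r)"
      using elim suminf_split_initial_segment[OF summable_fps[of z F], of R] by (simp add: eval_fps_def)
    moreover have "(\<lambda>r. fps_nth (fps_shift R F) r * z ^ r) sums ?g z"
      using elim by (intro sums_eval_fps) simp
    then have "(\<lambda>r. fps_nth F (r + R) * z ^ (r + R)) sums (?g z * z ^ R)"
      using sums_mult2[of "\<lambda>r. fps_nth (fps_shift R F) r * z ^ r" "?g z" "z ^ R"]
      by (simp add: power_add mult.assoc)
    ultimately show ?case by (simp add: sums_iff)
  qed
  have "(?g \<longlongrightarrow> ?g 0) (nhds 0)"
    using continuous_eval_fps[of 0 "fps_shift R F" UNIV] \<open>fps_conv_radius F > 0\<close>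
    by (simp add: continuous_within tendsto_nhds_iff zero_ereal_def)
  then have "?g \<in> O[nhds 0](\<lambda>_. 1)"
    by (intro bigoI_tendsto[where c = "?g 0"]) auto
  then have "(\<lambda>z. ?g z * z ^ R) \<in> O[nhds 0](\<lambda>z. 1 * z ^ R)"
    by (intro landau_o.big.mult) auto
  then show ?thesis
    using landau_o.big.in_cong[OF eq] by simp
qed

text \<open>Factor t^b out of (t + a)^b and apply the binomial series to z = a/t, which tends to
  0.\<close>

lemma shifted_powr_expansion:
  fixes a :: real and b :: complex
  shows "(\<lambda>t. of_real (t + a) powr b - (\<Sum>r<R. (b gchoose r) * of_real a ^ r * of_real t powr (b - of_nat r)))
           \<in> O(\<lambda>t. t powr (Re b - real R))"
proof -
  let ?e = "\<lambda>z. (1 + z) powr b - (\<Sum>r<R. (b gchoose r) * z ^ r)"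
  have "?e \<in> O[nhds 0](\<lambda>z. z ^ R)"
    using fps_expansion_remainder_bigo[OF has_fps_expansion_binomial_complex[of b], of R] by simp
  moreover have "filterlim (\<lambda>t. complex_of_real (a / t)) (nhds 0) at_top"
    using tendsto_of_real[OF real_tendsto_divide_at_top[OF tendsto_const filterlim_ident], of a, where ?'a = complex]
    by simp
  ultimately have "(\<lambda>t. ?e (complex_of_real (a / t))) \<in> O(\<lambda>t. complex_of_real (a / t) ^ R)"
    by (rule landau_o.big.compose)
  then have "(\<lambda>t. complex_of_real t powr b * ?e (of_real (a / t)))
      \<in> O(\<lambda>t. complex_of_real t powr b * of_real (a / t) ^ R)"
    by (intro landau_o.big.mult) auto
  also have "(\<lambda>t. complex_of_real t powr b * of_real (a / t) ^ R) \<in> O(\<lambda>t. t powr (Re b - real R))"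
  proof (rule bigoI[where c = "\<bar>a\<bar> ^ R"], use eventually_gt_at_top[of 0] in eventually_elim)
    case (elim t)
    then show ?case
      by (simp add: norm_mult norm_power norm_divide norm_powr_real_powr powr_diff powr_realpow power_divide mult.commute)
  qed
  finally have bnd: "(\<lambda>t. complex_of_real t powr b * ?e (of_real (a / t))) \<in> O(\<lambda>t. t powr (Re b - real R))" .
  have eq: "\<forall>\<^sub>F t in at_top. of_real t powr b * ?e (of_real (a / t)) =
    of_real (t + a) powr b - (\<Sum>r<R. (b gchoose r) * of_real a ^ r * of_real t powr (b - of_nat r))"
    using eventually_gt_at_top[of "\<bar>a\<bar>"]
  proof eventually_elim
    case (elim t)
    \<comment> \<open>Positivity of both factors makes the principal powers multiplicative.\<close>
    then have t: "t > 0" "1 + a / t > 0" by (auto simp: field_simps)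
    then have "complex_of_real (t + a) = of_real (t * (1 + a / t))" by (simp add: field_simps)
    then have "complex_of_real (t + a) powr b = of_real t powr b * of_real (1 + a / t) powr b"
      using t by (subst (asm) of_real_mult) (metis powr_times_real_left Reals_of_real Re_complex_of_real less_imp_le)
    moreover have "complex_of_real t powr (b - of_nat r) = of_real t powr b / of_real t ^ r" for r
      using t by (simp add: powr_diff powr_nat)
    ultimately show ?case
      by (simp add: right_diff_distrib sum_distrib_left power_divide mult_ac)
  qed
  show ?thesis
    using bnd unfolding landau_o.big.in_cong[OF eq] .
qed

section \<open>Moments of the correction polynomial\<close>

text \<open>These are the coefficients q_k of the polynomial \<Sum> \<gamma>_i (1 - \<xi>)^i in
  powers of \<xi>; summands with i < k vanish with the binomial coefficient.\<close>

definition backward_weight :: "nat \<Rightarrow> (nat \<Rightarrow> complex) \<Rightarrow> nat \<Rightarrow> complex" where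
  "backward_weight p \<gamma> k = (\<Sum>i<p. (-1) ^ k * of_nat (i choose k) * \<gamma> i)"

text \<open>The series \<open>x\<close> is left arbitrary because the identity is needed twice: at
  \<open>fps_X\<close> for the weights and at \<open>fps_exp (-1)\<close>, that is \<xi> = e^(-s),
  for the moments.\<close>

lemma sum_const_mult_one_minus_power:
  fixes x :: "complex fps"
  shows "(\<Sum>i<p. fps_const (\<gamma> i) * (1 - x) ^ i) = (\<Sum>k<p. fps_const (backward_weight p \<gamma> k) * x ^ k)"
proof -
  have pow: "(1 - x) ^ i = (\<Sum>k<p. fps_const ((-1) ^ k * of_nat (i choose k)) * x ^ k)" if "i < p" for i
  proof -
    have "(1 - x) ^ i = (\<Sum>k\<le>i. of_nat (i choose k) * (- x) ^ k * 1 ^ (i - k))"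
      using binomial_ring[of "- x" 1 i] by simp
    also have "\<dots> = (\<Sum>k\<le>i. fps_const ((-1) ^ k * of_nat (i choose k)) * x ^ k)"
      by (rule sum.cong) (auto simp: power_minus[of x] fps_of_nat fps_const_neg[symmetric]
          fps_const_power[symmetric] fps_const_mult[symmetric] simp del: fps_const_mult fps_const_power fps_const_neg)
    also have "\<dots> = (\<Sum>k<p. fps_const ((-1) ^ k * of_nat (i choose k)) * x ^ k)"
      using that by (intro sum.mono_neutral_left) auto
    finally show ?thesis .
  qed
  have "(\<Sum>i<p. fps_const (\<gamma> i) * (1 - x) ^ i)
      = (\<Sum>i<p. \<Sum>k<p. fps_const ((-1) ^ k * of_nat (i choose k) * \<gamma> i) * x ^ k)"
    by (intro sum.cong refl)
       (simp add: pow sum_distrib_left mult_ac fps_const_mult[symmetric] del: fps_const_mult)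
  also have "\<dots> = (\<Sum>k<p. fps_const (backward_weight p \<gamma> k) * x ^ k)"
    by (subst sum.swap) (simp add: fps_eq_iff fps_sum_nth backward_weight_def sum_distrib_right)
  finally show ?thesis .
qed

text \<open>Substitute \<xi> = e^(-s), so that the full series becomes e^(-\<theta> s). Since 1 -
  e^(-s) has no constant term, truncation after p terms preserves all coefficients below s^p. Hence
  \<Sum> q_k e^((\<theta> - k) s) = 1 + O(s^p), and the r-th moment is r! times the coefficient of
  s^r on the left.\<close>

lemma backward_weight_moments:
  assumes "\<forall>\<^sub>F \<xi> in nhds 1. (\<lambda>i. \<gamma> i * (1 - \<xi>) ^ i) sums (\<xi> powr \<theta>)" and "r < p"
  shows "(\<Sum>k<p. backward_weight p \<gamma> k * (\<theta> - of_nat k) ^ r) = (if r = 0 then 1 else 0)"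
proof -
  obtain d where d: "d > 0" "\<And>\<xi>. dist \<xi> 1 < d \<Longrightarrow> (\<lambda>i. \<gamma> i * (1 - \<xi>) ^ i) sums (\<xi> powr \<theta>)"
    using assms(1) unfolding eventually_nhds_metric by blast
  have sums: "(\<lambda>i. \<gamma> i * z ^ i) sums ((1 - z) powr \<theta>)" if "dist z 0 < d" for z
    using d(2)[of "1 - z"] that by (simp add: dist_norm)
  have "conv_radius \<gamma> \<ge> norm (of_real (d / 2) :: complex)"
    using sums[of "of_real (d / 2)"] d(1) by (intro conv_radius_geI) (auto simp: sums_iff)
  then have "fps_conv_radius (Abs_fps \<gamma>) > 0"
    using d(1) by (auto simp: fps_conv_radius_def intro: less_le_trans[rotated])
  moreover have "\<forall>\<^sub>F z in nhds 0. eval_fps (Abs_fps \<gamma>) z = (1 - z) powr \<theta>"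
    unfolding eventually_nhds_metric using d(1) sums by (intro exI[of _ d]) (auto simp: eval_fps_def sums_iff)
  ultimately have G: "(\<lambda>z. (1 - z) powr \<theta>) has_fps_expansion Abs_fps \<gamma>"
    by (simp add: has_fps_expansion_def)
  define E where "E = 1 - fps_exp (-1 :: complex)"
  have "(\<lambda>s::complex. 1 - exp (- s)) has_fps_expansion E"
    unfolding E_def by (intro fps_expansion_intros)
  from has_fps_expansion_compose[OF G this]
  have "((\<lambda>z. (1 - z) powr \<theta>) \<circ> (\<lambda>s. 1 - exp (- s))) has_fps_expansion (Abs_fps \<gamma> oo E)"
    by (simp add: E_def)
  moreover have "\<forall>\<^sub>F s in nhds 0. ((\<lambda>z. (1 - z) powr \<theta>) \<circ> (\<lambda>s. 1 - exp (- s))) s = exp (- \<theta> * s)"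
    unfolding eventually_nhds_metric
  proof (intro exI[of _ 1] conjI allI impI)
    fix s :: complex assume "dist s 0 < 1"
    \<comment> \<open>Staying in the strip |Im s| < pi lets the principal logarithm undo
      exp.\<close>
    then have "\<bar>Im s\<bar> < 1" using abs_Im_le_cmod[of s] by simp
    then have "Ln (exp (- s)) = - s" using pi_gt3 by (intro Ln_exp) auto
    then show "((\<lambda>z. (1 - z) powr \<theta>) \<circ> (\<lambda>s. 1 - exp (- s))) s = exp (- \<theta> * s)"
      by (simp add: powr_def)
  qed simp
  ultimately have "(\<lambda>s. exp (- \<theta> * s)) has_fps_expansion (Abs_fps \<gamma> oo E)"
    by (subst (asm) has_fps_expansion_cong) auto
  then have GE: "Abs_fps \<gamma> oo E = fps_exp (- \<theta>)"
    using has_fps_expansion_exp by (rule fps_expansion_unique_complex)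
  define Q where "Q = (\<Sum>i<p. fps_const (\<gamma> i) * E ^ i)"
  have Q: "fps_nth Q n = fps_nth (fps_exp (- \<theta>)) n" if "n < p" for n
  proof -
    have "fps_nth Q n = (\<Sum>i<p. \<gamma> i * fps_nth (E ^ i) n)"
      by (simp add: Q_def fps_sum_nth)
    \<comment> \<open>\<open>E ^ i\<close> starts at order i, so only i \<le> n < p contributes,
      exactly as in the infinite composition.\<close>
    also have "\<dots> = (\<Sum>i=0..n. \<gamma> i * fps_nth (E ^ i) n)"
      using that startsby_zero_power_prefix[of E] by (intro sum.mono_neutral_right) (auto simp: E_def)
    finally show ?thesis by (simp add: GE[symmetric] fps_compose_nth)
  qed
  have "fps_nth (fps_exp \<theta> * Q) r = fps_nth (fps_exp \<theta> * fps_exp (- \<theta>)) r"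
    using assms(2) by (auto simp: fps_mult_nth Q intro!: sum.cong)
  also have "\<dots> = (if r = 0 then 1 else 0)"
    unfolding fps_exp_add_mult[symmetric] by simp
  finally have "fps_nth (fps_exp \<theta> * Q) r = (if r = 0 then 1 else 0)" .
  moreover have "Q = (\<Sum>k<p. fps_const (backward_weight p \<gamma> k) * fps_exp (-1) ^ k)"
    unfolding Q_def E_def by (rule sum_const_mult_one_minus_power)
  then have "fps_exp \<theta> * Q = (\<Sum>k<p. fps_const (backward_weight p \<gamma> k) * fps_exp (\<theta> - of_nat k))"
    using fps_exp_add_mult[of \<theta> "- of_nat k" for k]
    by (simp add: sum_distrib_left fps_exp_power_mult mult_ac)
  then have "fps_nth (fps_exp \<theta> * Q) r = (\<Sum>k<p. backward_weight p \<gamma> k * (\<theta> - of_nat k) ^ r) / fact r"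
    by (simp add: fps_sum_nth sum_divide_distrib)
  ultimately show ?thesis by (auto split: if_splits)
qed

section \<open>Rescaling to unit step size\<close>

text \<open>Extension by 0 to the negative axis lets sums with different cut-off points share one
  index range.\<close>

definition cut_power :: "complex \<Rightarrow> real \<Rightarrow> complex" where
  "cut_power \<beta> t = (if 0 \<le> t then power_fun \<beta> t else 0)"

text \<open>This is the quadrature sum at unit step size; the shift is absorbed into
  \<open>y\<close>.\<close>

definition weighted_power_sum :: "complex fps \<Rightarrow> complex \<Rightarrow> real \<Rightarrow> complex" where
  "weighted_power_sum \<omega> \<beta> y = (\<Sum>j | real j \<le> y. fps_nth \<omega> j * power_fun \<beta> (y - real j))"

lemma weighted_power_sum_eq:
  assumes "y < real J"
  shows "weighted_power_sum \<omega> \<beta> y = (\<Sum>j<J. fps_nth \<omega> j * cut_power \<beta> (y - real j))"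
proof -
  have "{j. real j \<le> y} \<subseteq> {..<J}"
  proof
    fix j assume "j \<in> {j. real j \<le> y}"
    then have "real j < real J" using assms by simp
    then show "j \<in> {..<J}" by simp
  qed
  then show ?thesis unfolding weighted_power_sum_def
    by (intro sum.mono_neutral_cong_left) (auto simp: cut_power_def)
qed

lemma power_fun_scale:
  assumes "h > 0" "t \<ge> 0"
  shows "power_fun \<beta> (h * t) = of_real h powr (\<beta> - 1) * power_fun \<beta> t"
  using assms by (simp add: power_fun_def powr_times_real_left)

text \<open>Homogeneity of t^(\<beta>-1) moves the step size out of every sample.\<close>

lemma scq_power_fun:
  assumes "h > 0"
  shows "scq \<alpha> \<omega> \<theta> h (power_fun \<beta>) 1
    = of_real h powr (\<alpha> + \<beta> - 1) * weighted_power_sum \<omega> \<beta> (1 / h + \<theta>)"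
proof -
  have "{j. real j * h \<le> 1 + \<theta> * h} = {j. real j \<le> 1 / h + \<theta>}"
    using assms by (auto simp: field_simps)
  moreover have "power_fun \<beta> (1 + (\<theta> - real j) * h) = of_real h powr (\<beta> - 1) * power_fun \<beta> (1 / h + \<theta> - real j)"
    if "real j \<le> 1 / h + \<theta>" for j
    using power_fun_scale[of h "1 / h + \<theta> - real j" \<beta>] assms that by (simp add: algebra_simps)
  ultimately have "scq \<alpha> \<omega> \<theta> h (power_fun \<beta>) 1 = of_real h powr \<alpha> *
      (\<Sum>j | real j \<le> 1 / h + \<theta>. of_real h powr (\<beta> - 1) * (fps_nth \<omega> j * power_fun \<beta> (1 / h + \<theta> - real j)))"
    unfolding scq_def by (auto intro!: sum.cong)
  also have "\<dots> = of_real h powr (\<alpha> + (\<beta> - 1)) * weighted_power_sum \<omega> \<beta> (1 / h + \<theta>)"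
    unfolding weighted_power_sum_def sum_distrib_left[symmetric] using assms by (simp add: powr_add)
  finally show ?thesis by (simp add: add_diff_eq)
qed

text \<open>Scaling to unit step multiplies the error by a factor of modulus y^(Re \<alpha> + Re
  \<beta> - 1), which turns the bound h^min(Re \<beta>, p), with h = 1/y, into y to this
  power.\<close>

definition error_exponent :: "complex \<Rightarrow> complex \<Rightarrow> nat \<Rightarrow> real" where
  "error_exponent \<alpha> \<beta> p = Re \<alpha> - 1 + max 0 (Re \<beta> - real p)"

definition scaled_error :: "complex \<Rightarrow> complex fps \<Rightarrow> real \<Rightarrow> complex \<Rightarrow> real \<Rightarrow> complex" where
  "scaled_error \<alpha> \<omega> \<theta> \<beta> y =
     weighted_power_sum \<omega> \<beta> (y + \<theta>) - Gamma \<beta> * rGamma (\<alpha> + \<beta>) * of_real y powr (\<alpha> + \<beta> - 1)"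

lemma norm_scq_power_error:
  assumes "y > 0" "\<beta> \<notin> \<int>\<^sub>\<le>\<^sub>0"
  shows "norm (scq_power_error \<alpha> \<omega> \<theta> (inverse y) \<beta> 1)
    = y powr (1 - Re \<alpha> - Re \<beta>) * norm (scaled_error \<alpha> \<omega> \<theta> \<beta> y)"
proof -
  define w where "w = complex_of_real (inverse y) powr (\<alpha> + \<beta> - 1)"
  have "w * of_real y powr (\<alpha> + \<beta> - 1) = 1"
    using assms(1) powr_times_real[of "of_real (inverse y)" "complex_of_real y" "\<alpha> + \<beta> - 1"]
    by (simp add: w_def)
  then have "scq_power_error \<alpha> \<omega> \<theta> (inverse y) \<beta> 1 = w * scaled_error \<alpha> \<omega> \<theta> \<beta> y"
    using assms scq_power_fun[of "inverse y" \<alpha> \<omega> \<theta> \<beta>]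
    by (simp add: scq_power_error_def scaled_error_def RL_power_eq w_def[symmetric] right_diff_distrib
        mult.left_commute[of w] inverse_eq_divide[symmetric] del: of_real_inverse)
  moreover have "norm w = y powr - (Re \<alpha> + Re \<beta> - 1)"
    using assms(1)
    by (simp add: w_def norm_powr_real_powr inverse_powr powr_minus del: of_real_inverse minus_diff_eq)
  then have "norm w = y powr (1 - Re \<alpha> - Re \<beta>)" by (simp add: algebra_simps)
  ultimately show ?thesis by (simp add: norm_mult)
qed

lemma scq_power_error_bigo_iff:
  assumes "G \<le> at_top" "\<beta> \<notin> \<int>\<^sub>\<le>\<^sub>0"
  shows "(\<lambda>y. scq_power_error \<alpha> \<omega> \<theta> (inverse y) \<beta> 1) \<in> O[G](\<lambda>y. y powr - min (Re \<beta>) (real p))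
    \<longleftrightarrow> scaled_error \<alpha> \<omega> \<theta> \<beta> \<in> O[G](\<lambda>y. y powr error_exponent \<alpha> \<beta> p)"
proof -
  have "\<forall>\<^sub>F y in G. y > 0"
    using assms(1) eventually_gt_at_top filter_leD by blast
  then have "(\<forall>\<^sub>F y in G. norm (scq_power_error \<alpha> \<omega> \<theta> (inverse y) \<beta> 1) \<le> c * norm (complex_of_real (y powr - min (Re \<beta>) (real p))))
      \<longleftrightarrow> (\<forall>\<^sub>F y in G. norm (scaled_error \<alpha> \<omega> \<theta> \<beta> y) \<le> c * norm (complex_of_real (y powr error_exponent \<alpha> \<beta> p)))" for c
  proof (intro eventually_cong)
    fix y :: real assume y: "y > 0"
    have "- min (Re \<beta>) (real p) = (1 - Re \<alpha> - Re \<beta>) + error_exponent \<alpha> \<beta> p"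
      by (auto simp: error_exponent_def)
    then have "y powr - min (Re \<beta>) (real p) = y powr (1 - Re \<alpha> - Re \<beta>) * y powr error_exponent \<alpha> \<beta> p"
      by (simp add: powr_add)
    then show "norm (scq_power_error \<alpha> \<omega> \<theta> (inverse y) \<beta> 1) \<le> c * norm (complex_of_real (y powr - min (Re \<beta>) (real p)))
      \<longleftrightarrow> norm (scaled_error \<alpha> \<omega> \<theta> \<beta> y) \<le> c * norm (complex_of_real (y powr error_exponent \<alpha> \<beta> p))"
      using y by (simp add: norm_scq_power_error[OF y assms(2)] mult.left_commute[of c] norm_mult)
  qed
  then show ?thesis by (simp add: bigo_def)
qed

text \<open>For h \<le> 1 a sum of an O(h^\<beta>) and an O(h^p) is O(h^min(Re \<beta>, p)).
  Conversely the whole error is assigned to the weaker of the two bounds and the other summand is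
  0.\<close>

lemma scq_convergent_iff:
  assumes "G \<le> at_top"
  shows "scq_convergent (filtermap inverse G) \<alpha> \<omega> \<theta> p \<longleftrightarrow>
    (\<forall>\<beta>. \<beta> \<notin> \<int>\<^sub>\<le>\<^sub>0 \<longrightarrow> scaled_error \<alpha> \<omega> \<theta> \<beta> \<in> O[G](\<lambda>y. y powr error_exponent \<alpha> \<beta> p))"
proof -
  have pos: "\<forall>\<^sub>F y in G. y \<ge> 1"
    using assms eventually_ge_at_top filter_leD by blast
  have "(\<exists>u v. u \<in> O[filtermap inverse G](\<lambda>h. complex_of_real h powr \<beta>) \<and>
               v \<in> O[filtermap inverse G](\<lambda>h. complex_of_real h ^ p) \<and>
               (\<forall>\<^sub>F h in filtermap inverse G. scq_power_error \<alpha> \<omega> \<theta> h \<beta> 1 = u h + v h))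
      \<longleftrightarrow> (\<lambda>y. scq_power_error \<alpha> \<omega> \<theta> (inverse y) \<beta> 1) \<in> O[G](\<lambda>y. y powr - min (Re \<beta>) (real p))"
    (is "(\<exists>u v. ?P u v) \<longleftrightarrow> ?e \<in> O[G](?g)") for \<beta>
  proof
    assume "\<exists>u v. ?P u v"
    then obtain u v where u: "(\<lambda>y. u (inverse y)) \<in> O[G](\<lambda>y. complex_of_real (inverse y) powr \<beta>)"
      and v: "(\<lambda>y. v (inverse y)) \<in> O[G](\<lambda>y. complex_of_real (inverse y) ^ p)"
      and ev: "\<forall>\<^sub>F y in G. ?e y = u (inverse y) + v (inverse y)"
      by (auto simp: landau_o.big.in_filtermap_iff eventually_filtermap)
    note u
    also have "(\<lambda>y. complex_of_real (inverse y) powr \<beta>) \<in> O[G](?g)"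
    proof (rule bigoI[where c = 1], use pos in eventually_elim)
      case (elim y)
      then show ?case
        by (auto simp: norm_powr_real_powr inverse_powr simp del: of_real_inverse simp flip: powr_minus intro!: powr_mono)
    qed
    finally have u': "(\<lambda>y. u (inverse y)) \<in> O[G](?g)" .
    note v
    also have "(\<lambda>y. complex_of_real (inverse y) ^ p) \<in> O[G](?g)"
    proof (rule bigoI[where c = 1], use pos in eventually_elim)
      case (elim y)
      then show ?case
        by (auto simp: norm_power norm_inverse powr_realpow[symmetric] power_inverse simp flip: powr_minus intro!: powr_mono)
    qed
    finally have "(\<lambda>y. v (inverse y)) \<in> O[G](?g)" .
    with u' show "?e \<in> O[G](?g)"
      unfolding landau_o.big.in_cong[OF ev] by (rule sum_in_bigo)
  next
    assume e: "?e \<in> O[G](?g)"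
    show "\<exists>u v. ?P u v"
    proof (cases "Re \<beta> \<le> p")
      case True
      have "?g \<in> O[G](\<lambda>y. complex_of_real (inverse y) powr \<beta>)"
      proof (rule bigoI[where c = 1], use pos in eventually_elim)
        case (elim y)
        then show ?case
          using True by (auto simp: norm_powr_real_powr inverse_powr simp del: of_real_inverse simp flip: powr_minus intro!: powr_mono)
      qed
      from landau_o.big.trans[OF e this] have "?P (\<lambda>h. scq_power_error \<alpha> \<omega> \<theta> h \<beta> 1) (\<lambda>_. 0)"
        by (simp add: landau_o.big.in_filtermap_iff)
      then show ?thesis by blast
    next
      case False
      have "?g \<in> O[G](\<lambda>y. complex_of_real (inverse y) ^ p)"
      proof (rule bigoI[where c = 1], use pos in eventually_elim)
        case (elim y)
        then show ?case
          using False by (auto simp: norm_power norm_inverse powr_realpow[symmetric] power_inverse simp flip: powr_minus intro!: powr_mono)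
      qed
      from landau_o.big.trans[OF e this] have "?P (\<lambda>_. 0) (\<lambda>h. scq_power_error \<alpha> \<omega> \<theta> h \<beta> 1)"
        by (simp add: landau_o.big.in_filtermap_iff)
      then show ?thesis by blast
    qed
  qed
  then show ?thesis
    unfolding scq_convergent_def by (simp add: scq_power_error_bigo_iff[OF assms])
qed

section \<open>Convolution with the correction polynomial and its expansion at infinity\<close>

lemma weighted_power_sum_mult:
  assumes "x < real J"
  shows "weighted_power_sum (\<omega> * (\<Sum>k<p. fps_const (q k) * fps_X ^ k)) \<beta> x
    = (\<Sum>m<J. fps_nth \<omega> m * (\<Sum>k<p. q k * cut_power \<beta> (x - real m - real k)))"
proof -
  define g where "g = (\<lambda>k j. (if k \<le> j then fps_nth \<omega> (j - k) * cut_power \<beta> (x - real j) else 0))"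
  have nth: "fps_nth (\<omega> * (\<Sum>k<p. fps_const (q k) * fps_X ^ k)) j = (\<Sum>k<p. q k * (if k \<le> j then fps_nth \<omega> (j - k) else 0))" for j
    by (auto simp: sum_distrib_left fps_sum_nth mult.left_commute[of \<omega>] fps_mult_right_const_nth
        fps_X_power_mult_right_nth intro!: sum.cong)
  have shift: "(\<Sum>j<J. g k j) = (\<Sum>m<J. fps_nth \<omega> m * cut_power \<beta> (x - real m - real k))" for k
  proof -
    \<comment> \<open>The added indices j \<ge> J > x give negative arguments, where
      \<open>cut_power\<close> vanishes; this leaves room for the reindexing j = m + k.\<close>
    have "(\<Sum>j<J. g k j) = (\<Sum>j<J + k. g k j)"
      using assms by (intro sum.mono_neutral_left) (auto simp: g_def cut_power_def)
    also have "\<dots> = (\<Sum>j=0+k..<J+k. g k j)"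
      by (intro sum.mono_neutral_right) (auto simp: g_def)
    also have "\<dots> = (\<Sum>m<J. g k (m + k))"
      by (simp only: sum.shift_bounds_nat_ivl atLeast0LessThan)
    finally show ?thesis by (simp add: g_def diff_diff_eq)
  qed
  have "weighted_power_sum (\<omega> * (\<Sum>k<p. fps_const (q k) * fps_X ^ k)) \<beta> x = (\<Sum>k<p. q k * (\<Sum>j<J. g k j))"
    unfolding weighted_power_sum_eq[OF assms] nth unfolding sum_distrib_right sum_distrib_left
    by (subst sum.swap) (auto simp: g_def intro!: sum.cong)
  also have "\<dots> = (\<Sum>m<J. fps_nth \<omega> m * (\<Sum>k<p. q k * cut_power \<beta> (x - real m - real k)))"
    unfolding shift sum_distrib_left by (subst sum.swap) (simp add: mult_ac)
  finally show ?thesis .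
qed

text \<open>The coefficient of t^(\<beta>-1-r) in \<Sum> q_k (t + \<theta> - k)^(\<beta>-1): a
  binomial coefficient times the r-th moment of q about \<theta>.\<close>

definition expansion_coeff :: "nat \<Rightarrow> (nat \<Rightarrow> complex) \<Rightarrow> real \<Rightarrow> complex \<Rightarrow> nat \<Rightarrow> complex" where
  "expansion_coeff p q \<theta> \<beta> r = ((\<beta> - 1) gchoose r) * (\<Sum>k<p. q k * (of_real \<theta> - of_nat k) ^ r)"

definition expansion_rest :: "nat \<Rightarrow> (nat \<Rightarrow> complex) \<Rightarrow> real \<Rightarrow> complex \<Rightarrow> nat \<Rightarrow> real \<Rightarrow> complex" where
  "expansion_rest p q \<theta> \<beta> R t = (\<Sum>k<p. q k * cut_power \<beta> (t + \<theta> - real k))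
     - (\<Sum>r<R. expansion_coeff p q \<theta> \<beta> r * cut_power (\<beta> - of_nat r) t)"

lemma cut_power_pos: "t > 0 \<Longrightarrow> cut_power \<beta> t = of_real t powr (\<beta> - 1)"
  by (simp add: cut_power_def power_fun_def)

lemma cut_power_neg: "t < 0 \<Longrightarrow> cut_power \<beta> t = 0"
  by (simp add: cut_power_def)

lemma expansion_rest_left: "t < - \<bar>\<theta>\<bar> \<Longrightarrow> expansion_rest p q \<theta> \<beta> R t = 0"
  by (simp add: expansion_rest_def cut_power_neg)

text \<open>Beyond |\<theta>| + p every sample point is positive and no cut-off is active, so the
  binomial expansion applies to each shift \<theta> - k.\<close>

lemma expansion_rest_bigo:
  "expansion_rest p q \<theta> \<beta> R \<in> O(\<lambda>t. t powr (Re \<beta> - 1 - real R))"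
proof -
  let ?e = "\<lambda>a t. complex_of_real (t + a) powr (\<beta> - 1)
      - (\<Sum>r<R. ((\<beta> - 1) gchoose r) * of_real a ^ r * of_real t powr (\<beta> - 1 - of_nat r))"
  have bnd: "(\<lambda>t. \<Sum>k<p. q k * ?e (\<theta> - real k) t) \<in> O(\<lambda>t. t powr (Re \<beta> - 1 - real R))"
    using shifted_powr_expansion[of "\<theta> - real k" "\<beta> - 1" R for k]
    by (intro big_sum_in_bigo landau_o.big.cmult_in_iff'[THEN iffD2] disjI2) (auto intro: landau_o.big.mult_in_1)
  have eq: "\<forall>\<^sub>F t in at_top. expansion_rest p q \<theta> \<beta> R t = (\<Sum>k<p. q k * ?e (\<theta> - real k) t)"
    using eventually_gt_at_top[of "\<bar>\<theta>\<bar> + real p"]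
  proof eventually_elim
    case (elim t)
    have "cut_power \<beta> (t + \<theta> - real k) = of_real (t + (\<theta> - real k)) powr (\<beta> - 1)" if "k < p" for k
      using elim that cut_power_pos[of "t + (\<theta> - real k)" \<beta>] by (simp add: add_diff_eq)
    then have "(\<Sum>k<p. q k * cut_power \<beta> (t + \<theta> - real k)) = (\<Sum>k<p. q k * of_real (t + (\<theta> - real k)) powr (\<beta> - 1))"
      by simp
    moreover have "cut_power (\<beta> - of_nat r) t = of_real t powr (\<beta> - 1 - of_nat r)" for r
      using elim cut_power_pos[of t "\<beta> - of_nat r"] by (simp add: algebra_simps)
    then have "(\<Sum>r<R. expansion_coeff p q \<theta> \<beta> r * cut_power (\<beta> - of_nat r) t)
       = (\<Sum>k<p. q k * (\<Sum>r<R. ((\<beta> - 1) gchoose r) * of_real (\<theta> - real k) ^ r * of_real t powr (\<beta> - 1 - of_nat r)))"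
      unfolding expansion_coeff_def sum_distrib_left sum_distrib_right
      by (subst sum.swap) (simp add: mult_ac)
    ultimately show ?case
      by (simp add: expansion_rest_def right_diff_distrib sum_subtractf)
  qed
  show ?thesis
    using bnd unfolding landau_o.big.in_cong[OF eq] .
qed

text \<open>Insert the expansion into the convolution and interchange the sums. The moments give
  coefficient 1 for r = 0 and 0 for 0 < r < p. \<open>J\<close> must exceed both y and y + \<theta>,
  as the unshifted and the shifted sums end at different points.\<close>

lemma scaled_error_decomposition:
  assumes "y < real J" "y + \<theta> < real J" "p > 0" "p \<le> R"
    and moments: "\<And>r. r < p \<Longrightarrow> (\<Sum>k<p. q k * (of_real \<theta> - of_nat k) ^ r) = (if r = 0 then 1 else 0)"
  shows "scaled_error \<alpha> (\<omega> * (\<Sum>k<p. fps_const (q k) * fps_X ^ k)) \<theta> \<beta> y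
    = scaled_error \<alpha> \<omega> 0 \<beta> y
      + (\<Sum>r=p..<R. expansion_coeff p q \<theta> \<beta> r * weighted_power_sum \<omega> (\<beta> - of_nat r) y)
      + (\<Sum>m<J. fps_nth \<omega> m * expansion_rest p q \<theta> \<beta> R (y - real m))"
proof -
  let ?c = "expansion_coeff p q \<theta> \<beta>"
  have "weighted_power_sum (\<omega> * (\<Sum>k<p. fps_const (q k) * fps_X ^ k)) \<beta> (y + \<theta>)
      = (\<Sum>m<J. fps_nth \<omega> m * expansion_rest p q \<theta> \<beta> R (y - real m))
        + (\<Sum>m<J. \<Sum>r<R. ?c r * (fps_nth \<omega> m * cut_power (\<beta> - of_nat r) (y - real m)))"
    unfolding weighted_power_sum_mult[OF assms(2)] sum.distrib[symmetric]
  proof (intro sum.cong refl)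
    fix m
    show "fps_nth \<omega> m * (\<Sum>k<p. q k * cut_power \<beta> (y + \<theta> - real m - real k))
      = fps_nth \<omega> m * expansion_rest p q \<theta> \<beta> R (y - real m)
        + (\<Sum>r<R. ?c r * (fps_nth \<omega> m * cut_power (\<beta> - of_nat r) (y - real m)))"
      by (simp add: expansion_rest_def right_diff_distrib sum_distrib_left mult.left_commute diff_add_eq)
  qed
  also have "(\<Sum>m<J. \<Sum>r<R. ?c r * (fps_nth \<omega> m * cut_power (\<beta> - of_nat r) (y - real m)))
      = (\<Sum>r<R. ?c r * weighted_power_sum \<omega> (\<beta> - of_nat r) y)"
    unfolding weighted_power_sum_eq[OF assms(1)] sum_distrib_left by (rule sum.swap)
  also have "{..<R} = insert 0 {1..<p} \<union> {p..<R}" using assms(3,4) by auto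
  also have "(\<Sum>r\<in>insert 0 {1..<p} \<union> {p..<R}. ?c r * weighted_power_sum \<omega> (\<beta> - of_nat r) y)
      = weighted_power_sum \<omega> \<beta> y + (\<Sum>r=p..<R. ?c r * weighted_power_sum \<omega> (\<beta> - of_nat r) y)"
    using assms(3) moments[of 0] by (subst sum.union_disjoint) (auto simp: expansion_coeff_def moments)
  finally show ?thesis by (simp add: scaled_error_def)
qed

section \<open>Stability and the remainder\<close>

text \<open>Convolution sums involve all indices, so a bound valid only for large n does not
  suffice; positivity of \<open>g\<close> lets the finitely many exceptions be absorbed into the
  constant.\<close>

lemma sequence_bigoE:
  fixes f :: "nat \<Rightarrow> 'a :: real_normed_field" and g :: "nat \<Rightarrow> real"
  assumes "f \<in> O(\<lambda>n. of_real (g n))" and pos: "\<And>n. g n > 0"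
  obtains c where "c > 0" "\<And>n. norm (f n) \<le> c * g n"
proof -
  obtain c where c: "c > 0" "\<forall>\<^sub>F n in sequentially. norm (f n) \<le> c * norm (of_real (g n) :: 'a)"
    using landau_o.bigE[OF assms(1)] by blast
  then obtain N where N: "\<And>n. n \<ge> N \<Longrightarrow> norm (f n) \<le> c * g n"
    using pos by (auto simp: eventually_sequentially less_imp_le)
  define d where "d = c + (\<Sum>k<N. norm (f k) / g k)"
  have nonneg: "norm (f k) / g k \<ge> 0" for k using pos[of k] by simp
  show thesis
  proof
    show "d > 0" using c(1) nonneg by (auto simp: d_def intro!: add_pos_nonneg sum_nonneg)
    fix n
    show "norm (f n) \<le> d * g n"
    proof (cases "n < N")
      case True
      then have "norm (f n) / g n \<le> (\<Sum>k<N. norm (f k) / g k)"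
        using nonneg by (intro member_le_sum) auto
      then have "norm (f n) / g n \<le> d" using c(1) by (simp add: d_def)
      then show ?thesis using pos[of n] by (simp add: field_simps)
    next
      case False
      have "c * g n \<le> d * g n"
        using pos[of n] nonneg by (intro mult_right_mono) (auto simp: d_def intro!: sum_nonneg)
      then show ?thesis using N[of n] False by simp
    qed
  qed
qed

text \<open>Everything follows from 1 + u \<le> (1 + v)(1 + |v - u|), with the roles of x and y
  exchanged when a < 0.\<close>

lemma peetre_inequality:
  fixes x y a :: real
  assumes "x \<ge> 0" "y \<ge> 0"
  shows "(1 + x) powr a \<le> (1 + y) powr a * (1 + \<bar>y - x\<bar>) powr \<bar>a\<bar>"
proof -
  have *: "1 + u \<le> (1 + v) * (1 + \<bar>v - u\<bar>)" if "u \<ge> 0" "v \<ge> 0" for u v :: real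
  proof -
    have "v * \<bar>v - u\<bar> \<ge> 0" using that by simp
    then show ?thesis by (auto simp: algebra_simps)
  qed
  show ?thesis
  proof (cases "a \<ge> 0")
    case True
    then have "(1 + x) powr a \<le> ((1 + y) * (1 + \<bar>y - x\<bar>)) powr a"
      using *[of x y] assms by (intro powr_mono2) auto
    then show ?thesis using True assms by (simp add: powr_mult)
  next
    case False
    then have "((1 + x) * (1 + \<bar>y - x\<bar>)) powr a \<le> (1 + y) powr a"
      using *[of y x] assms by (intro powr_mono2') (auto simp: abs_minus_commute)
    then have "(1 + x) powr a * (1 + \<bar>y - x\<bar>) powr a * (1 + \<bar>y - x\<bar>) powr (- a)
        \<le> (1 + y) powr a * (1 + \<bar>y - x\<bar>) powr (- a)"
      using assms by (intro mult_right_mono) (auto simp: powr_mult)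
    moreover have "(1 + \<bar>y - x\<bar>) powr a * (1 + \<bar>y - x\<bar>) powr (- a) = 1"
      by (simp flip: powr_add)
    ultimately show ?thesis using False by (simp add: mult.assoc)
  qed
qed

text \<open>Each side of N contributes at most \<zeta>(2), whatever N and J are.\<close>

lemma sum_inverse_squares_distance_le:
  fixes N J :: nat
  shows "(\<Sum>m<J. (1 + \<bar>real N - real m\<bar>) powr - 2) \<le> 2 * (pi\<^sup>2 / 6)"
proof -
  let ?f = "\<lambda>n::nat. 1 / (real n + 1)\<^sup>2"
  have f: "sum ?f A \<le> pi\<^sup>2 / 6" if "finite A" for A
    using sum_le_suminf[OF sums_summable[OF inverse_squares_sums] that] inverse_squares_sums
    by (simp add: sums_iff add.commute)
  have eq: "(1 + \<bar>real N - real m\<bar>) powr - 2 = (if m \<le> N then ?f (N - m) else ?f (m - N))" for m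
    by (auto simp: powr_minus powr_numeral divide_inverse add.commute of_nat_diff)
  have "(\<Sum>m<J. (1 + \<bar>real N - real m\<bar>) powr - 2)
      \<le> (\<Sum>m\<in>{..N} \<union> {N<..<J}. (1 + \<bar>real N - real m\<bar>) powr - 2)"
    by (intro sum_mono2) auto
  also have "\<dots> = (\<Sum>m\<le>N. ?f (N - m)) + (\<Sum>m\<in>{N<..<J}. ?f (m - N))"
    unfolding eq by (subst sum.union_disjoint) auto
  also have "(\<Sum>m\<le>N. ?f (N - m)) = sum ?f ((\<lambda>m. N - m) ` {..N})"
    by (subst sum.reindex) (auto simp: inj_on_def)
  also have "(\<Sum>m\<in>{N<..<J}. ?f (m - N)) = sum ?f ((\<lambda>m. m - N) ` {N<..<J})"
    by (subst sum.reindex) (auto simp: inj_on_def)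
  also have "sum ?f ((\<lambda>m. N - m) ` {..N}) + sum ?f ((\<lambda>m. m - N) ` {N<..<J}) \<le> pi\<^sup>2 / 6 + pi\<^sup>2 / 6"
    by (intro add_mono f) auto
  finally show ?thesis by simp
qed

text \<open>Peetre's inequality trades (1 + m)^a for (1 + N)^a at the price of (1 + |N - m|)^|a|;
  the exponent -2 that remains is summable.\<close>

lemma convolution_powr_bound:
  fixes N J :: nat
  shows "(\<Sum>m<J. (1 + real m) powr a * (1 + \<bar>real N - real m\<bar>) powr - (\<bar>a\<bar> + 2))
    \<le> 2 * (pi\<^sup>2 / 6) * (1 + real N) powr a"
proof -
  have "(1 + real m) powr a * (1 + \<bar>real N - real m\<bar>) powr - (\<bar>a\<bar> + 2)
      \<le> (1 + real N) powr a * (1 + \<bar>real N - real m\<bar>) powr - 2" for m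
  proof -
    let ?d = "1 + \<bar>real N - real m\<bar>"
    have "(1 + real m) powr a * ?d powr - (\<bar>a\<bar> + 2)
        \<le> (1 + real N) powr a * ?d powr \<bar>a\<bar> * ?d powr - (\<bar>a\<bar> + 2)"
      by (intro mult_right_mono peetre_inequality) auto
    also have "\<dots> = (1 + real N) powr a * ?d powr - 2"
      by (simp add: mult.assoc flip: powr_add)
    finally show ?thesis .
  qed
  then have "(\<Sum>m<J. (1 + real m) powr a * (1 + \<bar>real N - real m\<bar>) powr - (\<bar>a\<bar> + 2))
      \<le> (1 + real N) powr a * (\<Sum>m<J. (1 + \<bar>real N - real m\<bar>) powr - 2)"
    unfolding sum_distrib_left by (intro sum_mono)
  also have "\<dots> \<le> (1 + real N) powr a * (2 * (pi\<^sup>2 / 6))"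
    by (intro mult_left_mono sum_inverse_squares_distance_le) auto
  finally show ?thesis by (simp add: mult.commute)
qed

text \<open>On grid points \<open>H\<close> is sampled only at integers and decays in |N - m|: on
  the right by assumption, on the left because it vanishes there eventually. The bound is uniform in
  the number of summands, so \<open>J\<close> is unrestricted.\<close>

lemma convolution_rest_bigo:
  fixes w :: "nat \<Rightarrow> complex" and H :: "real \<Rightarrow> complex" and J :: "nat \<Rightarrow> nat" and a B :: real
  assumes w: "w \<in> O(\<lambda>n. real n powr a)"
    and H: "H \<in> O(\<lambda>t. complex_of_real (t powr - (\<bar>a\<bar> + 2)))" and left: "\<And>t. t < - B \<Longrightarrow> H t = 0"
  shows "(\<lambda>N. \<Sum>m<J N. w m * H (real N - real m)) \<in> O(\<lambda>N. real N powr a)"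
proof -
  let ?g = "\<lambda>n::nat. (1 + real n) powr - (\<bar>a\<bar> + 2)"
  note w
  \<comment> \<open>Passing to 1 + n makes the comparison function positive at n = 0 as well, where
    \<open>0 powr a\<close> is 0.\<close>
  also have "(\<lambda>n. complex_of_real (real n powr a)) \<in> O(\<lambda>n. of_real ((1 + real n) powr a))"
    unfolding landau_o.big.of_real_iff by real_asymp
  finally obtain K where K: "K > 0" "\<And>n. norm (w n) \<le> K * (1 + real n) powr a"
    by (rule sequence_bigoE) auto
  have "(\<lambda>n. H (real n)) \<in> O(\<lambda>n. real n powr - (\<bar>a\<bar> + 2))"
    using landau_o.big.compose[OF H filterlim_real_sequentially] .
  also have "(\<lambda>n. complex_of_real (real n powr - (\<bar>a\<bar> + 2))) \<in> O(\<lambda>n. of_real (?g n))"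
    unfolding landau_o.big.of_real_iff by real_asymp
  finally obtain L where L: "L > 0" "\<And>n. norm (H (real n)) \<le> L * ?g n"
    by (rule sequence_bigoE) auto
  have "\<forall>\<^sub>F n in sequentially. real n > B"
    using filterlim_real_sequentially eventually_gt_at_top by (auto simp: filterlim_iff)
  then have "\<forall>\<^sub>F n in sequentially. H (- real n) = 0"
    by eventually_elim (simp add: left)
  then have "(\<lambda>n. H (- real n)) \<in> O(\<lambda>n. of_real (?g n))"
    by (rule landau_o.big.in_cong[THEN iffD2]) simp
  then obtain M where M: "M > 0" "\<And>n. norm (H (- real n)) \<le> M * ?g n"
    by (rule sequence_bigoE) auto
  have H': "norm (H (real N - real m)) \<le> (L + M) * (1 + \<bar>real N - real m\<bar>) powr - (\<bar>a\<bar> + 2)" for N m :: nat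
  proof (cases "m \<le> N")
    case True
    have "norm (H (real N - real m)) \<le> L * ?g (N - m)" using L(2)[of "N - m"] True by (simp add: of_nat_diff)
    also have "\<dots> \<le> (L + M) * ?g (N - m)" using M(1) by (intro mult_right_mono) auto
    finally show ?thesis using True by (simp add: of_nat_diff)
  next
    case False
    have "norm (H (real N - real m)) \<le> M * ?g (m - N)" using M(2)[of "m - N"] False by (simp add: of_nat_diff)
    also have "\<dots> \<le> (L + M) * ?g (m - N)" using L(1) by (intro mult_right_mono) auto
    finally show ?thesis using False by (simp add: of_nat_diff abs_minus_commute)
  qed
  have "norm (\<Sum>m<J N. w m * H (real N - real m)) \<le> K * (L + M) * (2 * (pi\<^sup>2 / 6)) * (1 + real N) powr a" for N
  proof -
    have "norm (\<Sum>m<J N. w m * H (real N - real m))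
        \<le> (\<Sum>m<J N. (K * (1 + real m) powr a) * ((L + M) * (1 + \<bar>real N - real m\<bar>) powr - (\<bar>a\<bar> + 2)))"
      unfolding norm_mult using K L M H' by (intro sum_norm_le) (auto simp: norm_mult intro!: mult_mono)
    also have "\<dots> = K * (L + M) * (\<Sum>m<J N. (1 + real m) powr a * (1 + \<bar>real N - real m\<bar>) powr - (\<bar>a\<bar> + 2))"
      by (simp add: sum_distrib_left mult_ac)
    also have "\<dots> \<le> K * (L + M) * (2 * (pi\<^sup>2 / 6) * (1 + real N) powr a)"
      using K L M by (intro mult_left_mono convolution_powr_bound) auto
    finally show ?thesis by (simp add: mult.assoc)
  qed
  then have "(\<lambda>N. \<Sum>m<J N. w m * H (real N - real m)) \<in> O(\<lambda>N. complex_of_real ((1 + real N) powr a))"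
    by (intro bigoI[where c = "K * (L + M) * (2 * (pi\<^sup>2 / 6))"]) simp
  also have "(\<lambda>N. complex_of_real ((1 + real N) powr a)) \<in> O(\<lambda>N. complex_of_real (real N powr a))"
    unfolding landau_o.big.of_real_iff by real_asymp
  finally show ?thesis .
qed

lemma powr_bigo_mono:
  fixes a b :: real
  assumes "G \<le> at_top" "a \<le> b"
  shows "(\<lambda>y. complex_of_real (y powr a)) \<in> O[G](\<lambda>y. of_real (y powr b))"
proof (rule landau_o.big.filter_mono[OF assms(1)], rule bigoI[where c = 1],
    use eventually_ge_at_top[of 1] in eventually_elim)
  case (elim y)
  then show ?case using assms(2) by (simp add: powr_mono)
qed

section \<open>Growth and support of the weights\<close>

lemma weights_bigo:
  assumes "scaled_error \<alpha> \<omega> 0 1 \<in> O[filtermap real sequentially](\<lambda>y. y powr error_exponent \<alpha> 1 p)" "p > 0"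
  shows "fps_nth \<omega> \<in> O(\<lambda>n. real n powr (Re \<alpha> - 1))"
proof -
  define a where "a = Re \<alpha> - 1"
  define C where "C = Gamma 1 * rGamma (\<alpha> + 1)"
  define e where "e = (\<lambda>n. scaled_error \<alpha> \<omega> 0 1 (real n))"
  \<comment> \<open>Since p \<ge> 1, the maximum in \<open>error_exponent\<close> is 0 at \<beta> =
    1.\<close>
  have e: "e \<in> O(\<lambda>n. complex_of_real (real n powr a))"
    using assms by (simp add: landau_o.big.in_filtermap_iff error_exponent_def e_def a_def)
  have "(\<lambda>n. e (n - 1)) \<in> O(\<lambda>n. complex_of_real (real (n - 1) powr a))"
    using landau_o.big.compose[OF e filterlim_minus_const_nat_at_top] by simp
  also have "(\<lambda>n. complex_of_real (real (n - 1) powr a)) \<in> O(\<lambda>n. complex_of_real (real n powr a))"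
  proof -
    have "\<forall>\<^sub>F n in sequentially. real (n - 1) powr a = (real n - 1) powr a"
      using eventually_ge_at_top[of 1] by eventually_elim (simp add: of_nat_diff)
    moreover have "(\<lambda>n. (real n - 1) powr a) \<in> O(\<lambda>n. real n powr a)" by real_asymp
    ultimately show ?thesis
      unfolding landau_o.big.of_real_iff by (simp only: landau_o.big.in_cong)
  qed
  finally have e': "(\<lambda>n. e (n - 1)) \<in> O(\<lambda>n. complex_of_real (real n powr a))" .
  have "(\<lambda>t. complex_of_real (t - 1) powr \<alpha> - of_real t powr \<alpha>) \<in> O(\<lambda>t. complex_of_real (t powr a))"
    using shifted_powr_expansion[of "-1" \<alpha> 1] by (simp add: a_def)
  from landau_o.big.compose[OF this filterlim_real_sequentially]
  have d: "(\<lambda>n. complex_of_real (real n - 1) powr \<alpha> - of_real (real n) powr \<alpha>) \<in> O(\<lambda>n. complex_of_real (real n powr a))"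
    by simp
  \<comment> \<open>At \<beta> = 1 and an integer node the quadrature is a partial sum of the
    weights, so consecutive differences isolate one weight; the main term C n^\<alpha> then loses
    one power of n.\<close>
  have sum_eq: "(\<Sum>j\<le>n. fps_nth \<omega> j) = e n + C * of_real (real n) powr \<alpha>" for n
    by (simp add: e_def scaled_error_def C_def weighted_power_sum_def power_fun_def atMost_def)
  have "\<forall>\<^sub>F n in sequentially. fps_nth \<omega> n
      = e n - e (n - 1) - C * (complex_of_real (real n - 1) powr \<alpha> - of_real (real n) powr \<alpha>)"
    using eventually_ge_at_top[of 1]
  proof eventually_elim
    case (elim n)
    then obtain k where n: "n = Suc k" by (cases n) auto
    have "fps_nth \<omega> n = (\<Sum>j\<le>n. fps_nth \<omega> j) - (\<Sum>j\<le>k. fps_nth \<omega> j)"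
      by (simp add: n)
    then show ?case unfolding sum_eq by (simp add: n algebra_simps)
  qed
  moreover have "(\<lambda>n. e n - e (n - 1) - C * (complex_of_real (real n - 1) powr \<alpha> - of_real (real n) powr \<alpha>))
      \<in> O(\<lambda>n. complex_of_real (real n powr a))"
    using d by (intro sum_in_bigo e e') (cases "C = 0"; simp)
  ultimately show ?thesis
    unfolding a_def by (simp only: landau_o.big.in_cong)
qed

text \<open>Evaluate at y = m + d with 0 < d < 1. The last sample contributes \<omega>_m d^(-1/2),
  while everything else stays bounded as d tends to 0 with m fixed, which forces \<omega>_m =
  0.\<close>

lemma weights_eventually_zero:
  assumes "scaled_error \<alpha> \<omega> 0 (1/2) \<in> O(\<lambda>y. y powr error_exponent \<alpha> (1/2) p)"
  obtains M where "\<And>m. m \<ge> M \<Longrightarrow> fps_nth \<omega> m = 0"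
proof -
  define e where "e = error_exponent \<alpha> (1/2) p"
  define C where "C = Gamma (1/2) * rGamma (\<alpha> + 1/2)"
  obtain c where c: "c > 0" "\<forall>\<^sub>F y in at_top. norm (scaled_error \<alpha> \<omega> 0 (1/2) y) \<le> c * norm (complex_of_real (y powr e))"
    using landau_o.bigE[OF assms] unfolding e_def by blast
  then obtain y0 where y0: "\<And>y. y \<ge> y0 \<Longrightarrow> norm (scaled_error \<alpha> \<omega> 0 (1/2) y) \<le> c * y powr e"
    by (auto simp: eventually_at_top_linorder)
  have "fps_nth \<omega> m = 0" if m: "m \<ge> nat \<lceil>max 1 y0\<rceil>" for m
  proof -
    have m1: "real m \<ge> 1" "real m \<ge> y0" using m by linarith+
    \<comment> \<open>Adding the values at both ends bounds (m + d)^b uniformly in d for either sign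
      of b.\<close>
    define P where "P = (\<lambda>b. real m powr b + (real m + 1) powr b)"
    have P: "(real m + d) powr b \<le> P b" if "0 < d" "d < 1" for d b
    proof (cases "b \<ge> 0")
      case True
      then have "(real m + d) powr b \<le> (real m + 1) powr b" using that by (intro powr_mono2) auto
      then show ?thesis by (simp add: P_def add_increasing)
    next
      case False
      then have "(real m + d) powr b \<le> real m powr b" using that m1 by (intro powr_mono2') auto
      then show ?thesis by (simp add: P_def add_increasing2)
    qed
    define K where "K = c * P e + norm C * P (Re \<alpha> - 1/2) + (\<Sum>j<m. norm (fps_nth \<omega> j))"
    have bound: "norm (fps_nth \<omega> m) \<le> K * d powr (1/2)" if d: "0 < d" "d < 1" for d
    proof -
      have "weighted_power_sum \<omega> (1/2) (real m + d)
          = (\<Sum>j<Suc m. fps_nth \<omega> j * cut_power (1/2) (real m + d - real j))"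
        using d by (intro weighted_power_sum_eq) simp
      also have "\<dots> = (\<Sum>j<m. fps_nth \<omega> j * cut_power (1/2) (real m + d - real j)) + fps_nth \<omega> m * of_real d powr (- (1/2))"
        using d by (simp add: cut_power_def power_fun_def)
      finally have "fps_nth \<omega> m * of_real d powr (- (1/2))
          = scaled_error \<alpha> \<omega> 0 (1/2) (real m + d) + C * of_real (real m + d) powr (\<alpha> - 1/2)
            - (\<Sum>j<m. fps_nth \<omega> j * cut_power (1/2) (real m + d - real j))"
        by (simp add: scaled_error_def C_def algebra_simps)
      also have "norm \<dots> \<le> norm (scaled_error \<alpha> \<omega> 0 (1/2) (real m + d)) + norm (C * of_real (real m + d) powr (\<alpha> - 1/2))
            + norm (\<Sum>j<m. fps_nth \<omega> j * cut_power (1/2) (real m + d - real j))"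
        by (meson norm_triangle_ineq norm_triangle_ineq4 add_right_mono order_trans)
      also have "\<dots> \<le> K"
        unfolding K_def
      proof (intro add_mono)
        show "norm (scaled_error \<alpha> \<omega> 0 (1/2) (real m + d)) \<le> c * P e"
          using y0[of "real m + d"] P[OF d, of e] c(1) m1 d by (meson add_increasing2 less_imp_le mult_left_mono order_trans)
        show "norm (C * of_real (real m + d) powr (\<alpha> - 1/2)) \<le> norm C * P (Re \<alpha> - 1/2)"
          unfolding norm_mult using P[OF d, of "Re \<alpha> - 1/2"] m1 d
          by (intro mult_left_mono) (simp_all add: norm_powr_real_powr del: of_real_add)
        show "norm (\<Sum>j<m. fps_nth \<omega> j * cut_power (1/2) (real m + d - real j)) \<le> (\<Sum>j<m. norm (fps_nth \<omega> j))"
        proof (intro sum_norm_le)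
          fix j assume "j \<in> {..<m}"
          then have "real j + 1 \<le> real m" by (simp flip: of_nat_Suc)
          \<comment> \<open>All earlier sample points stay at distance at least 1 from the
            singularity.\<close>
          then have j: "real m + d - real j \<ge> 1" using d by linarith
          have "norm (cut_power (1/2) (real m + d - real j)) = (real m + d - real j) powr (- (1/2))"
            using j by (simp add: cut_power_def power_fun_def norm_powr_real_powr del: of_real_diff of_real_add)
          also have "\<dots> \<le> 1" using powr_mono[of "- (1/2)" 0 "real m + d - real j"] j by simp
          finally show "norm (fps_nth \<omega> j * cut_power (1/2) (real m + d - real j)) \<le> norm (fps_nth \<omega> j)"
            unfolding norm_mult by (rule mult_left_le) simp
        qed
      qed
      finally have "norm (fps_nth \<omega> m) * d powr (- (1/2)) \<le> K"
        using d by (simp add: norm_mult norm_powr_real_powr)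
      then show ?thesis using d by (simp add: powr_minus divide_simps)
    qed
    have "norm (fps_nth \<omega> m) \<le> 0"
    proof (rule tendsto_lowerbound)
      show "((\<lambda>d. K * d powr (1/2)) \<longlongrightarrow> 0) (at_right 0)" by real_asymp
      show "\<forall>\<^sub>F d in at_right 0. norm (fps_nth \<omega> m) \<le> K * d powr (1/2)"
        using bound by (auto simp: eventually_at_right_field intro!: exI[of _ 1])
    qed simp
    then show ?thesis by simp
  qed
  then show thesis by (rule that)
qed

text \<open>With finitely many nonzero weights the sum is a fixed combination of translates of
  \<open>H\<close> as soon as y \<ge> M, and a translation does not change the order of
  decay.\<close>

lemma finite_rest_bigo:
  fixes w :: "nat \<Rightarrow> complex" and H :: "real \<Rightarrow> complex" and J :: "real \<Rightarrow> nat" and b :: real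
  assumes w: "\<And>m. m \<ge> M \<Longrightarrow> w m = 0" and J: "\<And>y. y < real (J y)"
    and H: "H \<in> O(\<lambda>t. t powr b)"
  shows "(\<lambda>y. \<Sum>m<J y. w m * H (y - real m)) \<in> O(\<lambda>y. y powr b)"
proof -
  have "(\<lambda>y. H (y - real m)) \<in> O(\<lambda>y. complex_of_real (y powr b))" for m
  proof -
    have "filterlim (\<lambda>y. y - real m) at_top at_top" by real_asymp
    then have "(\<lambda>y. H (y - real m)) \<in> O(\<lambda>y. complex_of_real ((y - real m) powr b))"
      by (rule landau_o.big.compose[OF H])
    also have "(\<lambda>y. complex_of_real ((y - real m) powr b)) \<in> O(\<lambda>y. complex_of_real (y powr b))"
      unfolding landau_o.big.of_real_iff by real_asymp
    finally show ?thesis .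
  qed
  then have "(\<lambda>y. \<Sum>m<M. w m * H (y - real m)) \<in> O(\<lambda>y. y powr b)"
    by (intro big_sum_in_bigo landau_o.big.mult_in_1) auto
  moreover have "\<forall>\<^sub>F y in at_top. (\<Sum>m<J y. w m * H (y - real m)) = (\<Sum>m<M. w m * H (y - real m))"
    using eventually_ge_at_top[of "real M"]
  proof eventually_elim
    case (elim y)
    then have "real M < real (J y)" using J[of y] by linarith
    then show ?case using w by (intro sum.mono_neutral_right) auto
  qed
  ultimately show ?thesis by (simp only: landau_o.big.in_cong)
qed

section \<open>Convergence of the shifted quadrature\<close>

text \<open>
  The hypothesis says nothing about the powers \<open>t\<^bsup>\<beta>-r-1\<^esup>\<close> with \<open>\<beta> - r = 0, -1, -2, \<dots>\<close>, but
  these do not occur: then \<open>t\<^bsup>\<beta>-1\<^esup>\<close> is a polynomial of degree less than \<open>r\<close>.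
\<close>
lemma expansion_coeff_eq_0:
  assumes "\<beta> \<notin> \<int>\<^sub>\<le>\<^sub>0" "\<beta> - of_nat r \<in> \<int>\<^sub>\<le>\<^sub>0"
  shows "expansion_coeff p q \<theta> \<beta> r = 0"
proof -
  obtain n where n: "\<beta> - of_nat r = - of_nat n"
    using assms(2) by (auto elim!: nonpos_Ints_cases')
  have "n < r"
  proof (rule ccontr)
    assume "\<not> n < r"
    then have "\<beta> = - of_nat (n - r)" using n by (simp add: of_nat_diff algebra_simps)
    then show False using assms(1) by simp
  qed
  then have "\<beta> - 1 = of_nat (r - n - 1)" using n by (simp add: of_nat_diff algebra_simps)
  then have "(\<beta> - 1) gchoose r = of_nat ((r - n - 1) choose r)" by (simp add: binomial_gbinomial)
  then show ?thesis using \<open>n < r\<close> by (simp add: expansion_coeff_def)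
qed

theorem theorem2p11:
  fixes \<alpha> :: complex and \<theta> :: real and p :: nat and \<omega>p \<omega> :: "complex fps"
    and \<gamma> :: "nat \<Rightarrow> complex" and F :: "real filter"
  assumes "F = at_right 0 \<or> F = filtermap (\<lambda>N. 1 / real N) sequentially"
    and "p > 0"
    and "cq_convergent F \<alpha> \<omega>p p"
    and "\<forall>\<^sub>F \<xi> in nhds (1 :: complex). (\<lambda>i. \<gamma> i * (1 - \<xi>) ^ i) sums (\<xi> powr of_real \<theta>)"
    and "\<omega> = \<omega>p * (\<Sum>i<p. fps_const (\<gamma> i) * (1 - fps_X) ^ i)"
  shows "scq_convergent F \<alpha> \<omega> \<theta> p"
proof -
  have "filtermap (\<lambda>N. 1 / real N) sequentially = filtermap inverse (filtermap real sequentially)"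
    by (simp add: filtermap_filtermap inverse_eq_divide)
  \<comment> \<open>In the variable y = 1/h both kinds of limit refine y tending to infinity:
    through all reals or through the integers.\<close>
  then obtain G where G: "G = at_top \<or> G = filtermap real sequentially" and FG: "F = filtermap inverse G"
    using assms(1) at_right_to_top by metis
  have le: "G \<le> at_top"
    using G filterlim_real_sequentially by (auto simp: filterlim_def)
  have conv: "scaled_error \<alpha> \<omega>p 0 \<beta> \<in> O[G](\<lambda>y. complex_of_real (y powr error_exponent \<alpha> \<beta> p))" if "\<beta> \<notin> \<int>\<^sub>\<le>\<^sub>0" for \<beta>
    using assms(3) that unfolding cq_convergent_def FG scq_convergent_iff[OF le] by blast
  define q where "q = backward_weight p \<gamma>"
  have \<omega>: "\<omega> = \<omega>p * (\<Sum>k<p. fps_const (q k) * fps_X ^ k)"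
    unfolding assms(5) q_def sum_const_mult_one_minus_power ..
  define J where "J = (\<lambda>y. nat \<lceil>y + \<bar>\<theta>\<bar>\<rceil> + 1)"
  have J: "y < real (J y)" "y + \<theta> < real (J y)" for y
    unfolding J_def by linarith+
  have "scaled_error \<alpha> \<omega> \<theta> \<beta> \<in> O[G](\<lambda>y. complex_of_real (y powr error_exponent \<alpha> \<beta> p))"
    (is "_ \<in> O[G](?b)") if \<beta>: "\<beta> \<notin> \<int>\<^sub>\<le>\<^sub>0" for \<beta>
  proof -
    define a where "a = Re \<alpha> - 1"
    \<comment> \<open>At least p terms are needed for the decomposition; the second entry makes the
      remainder decay like t^(-(|a| + 2)), as the convolution estimate requires.\<close>
    define R where "R = max p (nat \<lceil>Re \<beta> - 1 + \<bar>a\<bar> + 2\<rceil>)"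
    define H where "H = expansion_rest p q \<theta> \<beta> R"
    have R: "p \<le> R" "Re \<beta> - 1 - real R \<le> - (\<bar>a\<bar> + 2)"
      unfolding R_def by linarith+
    have H: "H \<in> O(\<lambda>t. complex_of_real (t powr - (\<bar>a\<bar> + 2)))"
      unfolding H_def using expansion_rest_bigo powr_bigo_mono[OF order_refl R(2)]
      by (rule landau_o.big.trans)
    have rest: "(\<lambda>y. \<Sum>m<J y. fps_nth \<omega>p m * H (y - real m)) \<in> O[G](\<lambda>y. complex_of_real (y powr a))"
      using G
    proof
      \<comment> \<open>For arbitrary step sizes the weights have finite support, so the decay of
        \<open>H\<close> itself suffices.\<close>
      assume G: "G = at_top"
      have "1/2 \<notin> (\<int>\<^sub>\<le>\<^sub>0 :: complex set)"
        by (auto elim!: nonpos_Ints_cases simp: complex_eq_iff)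
      then obtain M where M: "\<And>m. m \<ge> M \<Longrightarrow> fps_nth \<omega>p m = 0"
        using weights_eventually_zero[OF conv[unfolded G]] by blast
      have "H \<in> O(\<lambda>t. complex_of_real (t powr a))"
        using H powr_bigo_mono[OF order_refl, of "- (\<bar>a\<bar> + 2)" a] by (rule landau_o.big.trans) linarith
      with M J(1) show ?thesis unfolding G by (rule finite_rest_bigo)
    next
      \<comment> \<open>On grid points the weights may be infinitely many, but they grow at most
        like n^a.\<close>
      assume G: "G = filtermap real sequentially"
      have "fps_nth \<omega>p \<in> O(\<lambda>n. complex_of_real (real n powr a))"
        unfolding a_def using conv[of 1] assms(2) unfolding G by (intro weights_bigo) auto
      from convolution_rest_bigo[OF this H, of "\<bar>\<theta>\<bar>"] show ?thesis
        unfolding G landau_o.big.in_filtermap_iff by (simp add: H_def expansion_rest_left)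
    qed
    have "a \<le> error_exponent \<alpha> \<beta> p"
      by (simp add: a_def error_exponent_def)
    from landau_o.big.trans[OF rest powr_bigo_mono[OF le this]]
    have T3: "(\<lambda>y. \<Sum>m<J y. fps_nth \<omega>p m * H (y - real m)) \<in> O[G](?b)" .
    have T2: "(\<lambda>y. expansion_coeff p q \<theta> \<beta> r * weighted_power_sum \<omega>p (\<beta> - of_nat r) y) \<in> O[G](?b)"
      if r: "p \<le> r" for r
    proof (cases "\<beta> - of_nat r \<in> \<int>\<^sub>\<le>\<^sub>0")
      case True
      then show ?thesis by (simp add: expansion_coeff_eq_0[OF \<beta>])
    next
      case False
      define b where "b = \<beta> - of_nat r"
      have Re: "Re b = Re \<beta> - real r" by (simp add: b_def)
      have "error_exponent \<alpha> b p \<le> error_exponent \<alpha> \<beta> p"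
        using r by (auto simp: error_exponent_def Re)
      from landau_o.big.trans[OF conv[OF False[folded b_def]] powr_bigo_mono[OF le this]]
      have "scaled_error \<alpha> \<omega>p 0 b \<in> O[G](?b)" .
      \<comment> \<open>For r \<ge> p even the exact value of the fractional integral is within the
        bound: its exponent Re \<alpha> + Re \<beta> - r - 1 is at most Re \<alpha> - 1 + (Re
        \<beta> - p).\<close>
      moreover have "(\<lambda>y. Gamma b * rGamma (\<alpha> + b) * complex_of_real y powr (\<alpha> + b - 1)) \<in> O[G](?b)"
      proof (rule landau_o.big.trans)
        have "\<forall>\<^sub>F y in G. y > 0" using le eventually_gt_at_top filter_leD by blast
        then show "(\<lambda>y. Gamma b * rGamma (\<alpha> + b) * complex_of_real y powr (\<alpha> + b - 1))
            \<in> O[G](\<lambda>y. complex_of_real (y powr Re (\<alpha> + b - 1)))"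
          by (intro bigoI[where c = "norm (Gamma b * rGamma (\<alpha> + b))"], eventually_elim)
             (simp add: norm_mult norm_powr_real_powr)
        show "(\<lambda>y. complex_of_real (y powr Re (\<alpha> + b - 1))) \<in> O[G](?b)"
          using r by (intro powr_bigo_mono[OF le]) (auto simp: error_exponent_def Re)
      qed
      ultimately have "(\<lambda>y. scaled_error \<alpha> \<omega>p 0 b y + Gamma b * rGamma (\<alpha> + b) * complex_of_real y powr (\<alpha> + b - 1)) \<in> O[G](?b)"
        by (rule sum_in_bigo)
      then have "weighted_power_sum \<omega>p b \<in> O[G](?b)"
        by (simp add: scaled_error_def)
      then show ?thesis unfolding b_def
        by (cases "expansion_coeff p q \<theta> \<beta> r = 0") simp_all
    qed
    have "scaled_error \<alpha> \<omega> \<theta> \<beta> = (\<lambda>y. scaled_error \<alpha> \<omega>p 0 \<beta> y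
        + (\<Sum>r=p..<R. expansion_coeff p q \<theta> \<beta> r * weighted_power_sum \<omega>p (\<beta> - of_nat r) y)
        + (\<Sum>m<J y. fps_nth \<omega>p m * H (y - real m)))"
      unfolding \<omega> H_def using backward_weight_moments[OF assms(4)]
      by (intro ext scaled_error_decomposition J assms(2) R(1)) (simp add: q_def)
    also have "\<dots> \<in> O[G](?b)"
      by (intro sum_in_bigo(1) big_sum_in_bigo conv \<beta> T2 T3) auto
    finally show ?thesis .
  qed
  then show ?thesis
    unfolding FG scq_convergent_iff[OF le] by blast
qed

end
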